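(* Let $G$ be a finite group of order $n$ and let $\pi$ be a set of primes contained in the set $\pi(n)$ of prime divisors of $n$. Then $\psi_{\pi}(G)\leq\psi_{\pi}(C_n)$. Moreover, equality $\psi_{\pi}(G)=\psi_{\pi}(C_n)$ holds if and only if $G\cong H\rtimes C$, where $H$ is a normal subgroup of $G$ whose order is the $\pi'$-part of $n$ and $C$ is a cyclic subgroup of $G$ whose order is the $\pi$-part of $n$.
   Context: $C_n$ denotes the cyclic group of order $n$, and $o(x)$ denotes the order of an element $x$. For a set of primes $\pi$, $\pi'$ denotes the complementary set of primes. A $\pi$-number (respectively $\pi'$-number) is a positive integer all of whose prime divisors lie in $\pi$ (respectively in $\pi'$). The $\pi$-part (respectively $\pi'$-part) of $n$ is the largest divisor of $n$ that is a $\pi$-number (respectively a $\pi'$-number). Every element $x$ of a finite group $G$ can be written uniquely as $x=x_{\pi}x_{\pi'}=x_{\pi'}x_{\pi}$ with commuting factors $x_\pi,x_{\pi'}\in G$, where $o(x_{\pi})$ is a $\pi$-number and $o(x_{\pi'})$ is a $\pi'$-number. Define $$\psi_{\pi}(G)=\sum_{x\in G}o(x_{\pi}).$$ *)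

theory Defs
  imports "HOL-Algebra.Algebra" "HOL-Computational_Algebra.Primes"
begin

definition pi_number :: "nat set \<Rightarrow> nat \<Rightarrow> bool" where
  "pi_number \<pi> m \<longleftrightarrow> m > 0 \<and> (\<forall>p. Factorial_Ring.prime p \<and> p dvd m \<longrightarrow> p \<in> \<pi>)"

definition pi_compl :: "nat set \<Rightarrow> nat set" where
  "pi_compl \<pi> = {p. Factorial_Ring.prime p} - \<pi>"

definition pi_part :: "nat set \<Rightarrow> nat \<Rightarrow> nat" where
  "pi_part \<pi> n = Max {d. d dvd n \<and> pi_number \<pi> d}"

text \<open>For an element \<open>x\<close> of a finite group the factorisation below exists and is unique,
  so the description operator picks out the \<open>\<pi>\<close>-part \<open>x\<^sub>\<pi>\<close>; \<open>v\<close> is the \<open>\<pi>'\<close>-part.\<close>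

definition elem_pi_part :: "('a, 'b) monoid_scheme \<Rightarrow> nat set \<Rightarrow> 'a \<Rightarrow> 'a" where
  "elem_pi_part G \<pi> x =
     (THE u. u \<in> carrier G \<and>
        (\<exists>v \<in> carrier G. x = u \<otimes>\<^bsub>G\<^esub> v \<and> x = v \<otimes>\<^bsub>G\<^esub> u \<and>
           pi_number \<pi> (group.ord G u) \<and> pi_number (pi_compl \<pi>) (group.ord G v)))"

definition psi :: "nat set \<Rightarrow> ('a, 'b) monoid_scheme \<Rightarrow> nat" where
  "psi \<pi> G = (\<Sum>x \<in> carrier G. group.ord G (elem_pi_part G \<pi> x))"

text \<open>The semidirect product of \<open>N\<close> by \<open>K\<close>, where \<open>K\<close> acts on \<open>N\<close> through a homomorphism
  \<open>\<phi> \<in> hom K (AutoGroup N)\<close>.\<close>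

definition semidirect_product ::
  "('a, 'm) monoid_scheme \<Rightarrow> ('b, 'n) monoid_scheme \<Rightarrow> ('b \<Rightarrow> 'a \<Rightarrow> 'a) \<Rightarrow> ('a \<times> 'b) monoid" where
  "semidirect_product N K \<phi> =
     \<lparr>carrier = carrier N \<times> carrier K,
      monoid.mult = (\<lambda>(h, c) (h', c'). (h \<otimes>\<^bsub>N\<^esub> \<phi> c h', c \<otimes>\<^bsub>K\<^esub> c')),
      one = (\<one>\<^bsub>N\<^esub>, \<one>\<^bsub>K\<^esub>)\<rparr>"

end

theory Submission
  imports Defs "HOL-Number_Theory.Totient" "HOL-Number_Theory.Cong"
begin

text \<open>
  The order of \<open>x\<^sub>\<pi>\<close> is the \<open>\<pi>\<close>-part of the order of \<open>x\<close>. Induct on \<open>|\<pi>|\<close>, removing the largest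
  prime \<open>p\<close> of \<open>\<pi>\<close>; write \<open>n = p\<^sup>a n'\<close>. If \<open>\<psi>\<^sub>\<pi>(G)\<close> is at least the value for the cyclic group, then
  some \<open>o(x\<^sub>\<pi>)\<close> exceeds its maximal possible value divided by \<open>p\<close>, so that \<open>G\<close> has an element \<open>w\<close> of
  order \<open>p\<^sup>a\<close>. Suppose first that every such \<open>w\<close> is central in the normaliser of \<open>\<langle>w\<rangle>\<close>. For a
  \<open>p\<close>-element \<open>v\<close> the transfer homomorphism into \<open>\<langle>w\<rangle>\<close> gives the centraliser of \<open>v\<close> a normal
  \<open>p\<close>-complement \<open>K\<close>, and the elements with \<open>p\<close>-part \<open>v\<close> are those of \<open>vK\<close>; the induction hypothesis
  for \<open>K\<close>, summed over the conjugacy classes of \<open>p\<close>-elements (all of which meet \<open>\<langle>w\<rangle>\<close>), gives the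
  inequality, and in the case of equality the complements for \<open>v = 1\<close> and \<open>v = w\<close> provide the
  normal Hall subgroup and the cyclic one. Otherwise the generators of \<open>\<langle>w\<rangle>\<close> lie in at most
  half as many classes as there are generators, and with the crude bound \<open>p\<^sup>a\<^sup>-\<^sup>1\<close> for the order of
  the remaining \<open>p\<close>-parts the inequality is strict.
\<close>

section \<open>Parts of integers and the sum of element orders of a cyclic group\<close>

text \<open>The elements with p-part \<open>v\<close> are \<open>v\<close> times the p'-elements of
  its centraliser. These form a group, to which induction applies, only if that centraliser has a
  normal p-complement. A cyclic Sylow subgroup alone does not provide one, since its normaliser may
  act on it nontrivially; hence the case distinction. The prime removed is the largest because of an
  averaging argument. If \<open>m\<close> is the \<pi>-part of n, the cyclic value makes the mean of
  the orders of the \<pi>-parts exceed \<open>totient m\<close>, and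
  \<open>m \<le> p * totient m\<close> as soon as p bounds the prime divisors of \<open>m\<close>;
  so some order exceeds m/p. When there is fusion, the factor one half just compensates the crude
  bound: what remains is (p+1)(p^2+1) \<le> 2p^3, true from p = 2 on. The cyclic value for p^a is
  (p^(2a+1)+1)/(p+1), and its summand 1 gives strictness.\<close>

lemma pi_number_dvd: "pi_number \<pi> m \<Longrightarrow> d dvd m \<Longrightarrow> pi_number \<pi> d"
  unfolding pi_number_def by (metis dvd_trans dvd_0_left gr0I less_irrefl)

lemma pi_number_1 [simp]: "pi_number \<pi> 1" "pi_number \<pi> (Suc 0)"
  unfolding pi_number_def by auto

lemma pi_number_mult: "pi_number \<pi> a \<Longrightarrow> pi_number \<pi> b \<Longrightarrow> pi_number \<pi> (a * b)"
  unfolding pi_number_def by (auto simp: prime_dvd_mult_iff)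

lemma pi_number_pos: "pi_number \<pi> a \<Longrightarrow> a > 0"
  unfolding pi_number_def by auto

lemma pi_number_prime:
  "Factorial_Ring.prime p \<Longrightarrow> pi_number \<pi> p \<longleftrightarrow> p \<in> \<pi>"
  unfolding pi_number_def by (metis dvd_refl prime_gt_0_nat primes_dvd_imp_eq)

lemma pi_compl_compl: "pi_number (pi_compl (pi_compl \<pi>)) m \<longleftrightarrow> pi_number \<pi> m"
  unfolding pi_number_def pi_compl_def by auto

lemma pi_number_coprime:
  assumes "pi_number \<pi> a" "pi_number (pi_compl \<pi>) b"
  shows "coprime a b"
proof (rule ccontr)
  assume "\<not> coprime a b"
  then have "gcd a b \<noteq> 1" by (simp add: coprime_iff_gcd_eq_1)
  then obtain p where "Factorial_Ring.prime p" "p dvd gcd a b"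
    using prime_factor_nat by blast
  with assms show False unfolding pi_number_def pi_compl_def by auto
qed

lemma pi_number_factorisation:
  assumes "n > 0"
  shows "\<exists>d e. n = d * e \<and> pi_number \<pi> d \<and> pi_number (pi_compl \<pi>) e"
  using assms
proof (induction n rule: less_induct)
  case (less n)
  show ?case
  proof (cases "n = 1")
    case True
    then show ?thesis by (intro exI[of _ 1]) auto
  next
    case False
    then obtain p where p: "Factorial_Ring.prime p" "p dvd n" using prime_factor_nat by blast
    then obtain r where r: "n = p * r" by blast
    with less.prems have "r > 0" by simp
    moreover have "r < n" using r p(1) \<open>r > 0\<close> prime_gt_1_nat[OF p(1)] by auto
    ultimately obtain d e where de: "r = d * e" "pi_number \<pi> d" "pi_number (pi_compl \<pi>) e"
      using less.IH by blast
    show ?thesis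
    proof (cases "p \<in> \<pi>")
      case True
      then have "pi_number \<pi> (p * d)" using de p pi_number_mult pi_number_prime by blast
      then show ?thesis using de r by (metis mult.assoc)
    next
      case False
      then have "p \<in> pi_compl \<pi>" using p by (auto simp: pi_compl_def)
      then have "pi_number (pi_compl \<pi>) (p * e)" using de p pi_number_mult pi_number_prime by blast
      then show ?thesis using de r by (metis mult.left_commute)
    qed
  qed
qed

text \<open>A \<pi>-number dividing \<open>d * e\<close> is coprime to \<open>e\<close> and so
  divides \<open>d\<close>. The maximum in \<open>pi_part\<close> is handled through such
  factorisations from here on.\<close>

lemma pi_part_eqI:
  assumes "pi_number \<pi> d" "pi_number (pi_compl \<pi>) e" "n = d * e"
  shows "pi_part \<pi> n = d"
  unfolding pi_part_def
proof (rule Max_eqI)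
  have n: "n > 0" using assms pi_number_pos by auto
  then show "finite {d. d dvd n \<and> pi_number \<pi> d}" by simp
  show "d \<in> {d. d dvd n \<and> pi_number \<pi> d}" using assms by auto
  fix y assume "y \<in> {d. d dvd n \<and> pi_number \<pi> d}"
  then have "y dvd d * e" "coprime y e" using assms pi_number_coprime by auto
  then have "y dvd d" by (simp add: coprime_dvd_mult_left_iff)
  then show "y \<le> d" using assms pi_number_pos dvd_imp_le by blast
qed

lemma pi_part_props:
  assumes "n > 0"
  shows pi_part_mult_compl: "pi_part \<pi> n * pi_part (pi_compl \<pi>) n = n"
    and pi_number_pi_part: "pi_number \<pi> (pi_part \<pi> n)"
    and pi_part_pos: "pi_part \<pi> n > 0"
proof -
  obtain d e where de: "n = d * e" "pi_number \<pi> d" "pi_number (pi_compl \<pi>) e"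
    using pi_number_factorisation[OF assms] by blast
  have "pi_part \<pi> n = d" using de pi_part_eqI by blast
  moreover have "pi_part (pi_compl \<pi>) n = e"
    using de pi_part_eqI[of "pi_compl \<pi>" e d n] by (simp add: pi_compl_compl mult.commute)
  ultimately show "pi_part \<pi> n * pi_part (pi_compl \<pi>) n = n" "pi_number \<pi> (pi_part \<pi> n)"
      "pi_part \<pi> n > 0"
    using de pi_number_pos by auto
qed

lemma pi_part_dvd: "n > 0 \<Longrightarrow> pi_part \<pi> n dvd n"
  by (metis pi_part_mult_compl dvd_triv_left)

lemma coprime_pi_parts: "n > 0 \<Longrightarrow> coprime (pi_part \<pi> n) (pi_part (pi_compl \<pi>) n)"
  using pi_number_coprime pi_number_pi_part by blast

lemma pi_part_mult:
  assumes "a > 0" "b > 0"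
  shows "pi_part \<pi> (a * b) = pi_part \<pi> a * pi_part \<pi> b"
proof (rule pi_part_eqI)
  show "pi_number \<pi> (pi_part \<pi> a * pi_part \<pi> b)"
    "pi_number (pi_compl \<pi>) (pi_part (pi_compl \<pi>) a * pi_part (pi_compl \<pi>) b)"
    using assms pi_number_mult pi_number_pi_part by blast+
  show "a * b = pi_part \<pi> a * pi_part \<pi> b * (pi_part (pi_compl \<pi>) a * pi_part (pi_compl \<pi>) b)"
    using pi_part_mult_compl[OF assms(1), of \<pi>] pi_part_mult_compl[OF assms(2), of \<pi>]
    by (metis mult.assoc mult.left_commute)
qed

lemma pi_part_dvd_mono: "a dvd b \<Longrightarrow> b > 0 \<Longrightarrow> pi_part \<pi> a dvd pi_part \<pi> b"
  by (metis dvdE dvd_triv_left nat_0_less_mult_iff pi_part_mult)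

lemma pi_part_id: "pi_number \<pi> n \<Longrightarrow> pi_part \<pi> n = n"
  using pi_part_eqI[of \<pi> n 1 n] by simp

lemma pi_part_trivial: "pi_number (pi_compl \<pi>) n \<Longrightarrow> pi_part \<pi> n = 1"
  using pi_part_eqI[of \<pi> 1 n n] by simp

text \<open>Applied to orders of elements, this separates the contribution of p from that of \<pi>,
  which is what allows one prime to be removed at a time.\<close>

lemma pi_part_insert:
  assumes "Factorial_Ring.prime p" "p \<notin> \<pi>" "n > 0"
  shows "pi_part (insert p \<pi>) n = pi_part {p} n * pi_part \<pi> n"
proof (rule pi_part_eqI)
  let ?q = "pi_part {p} n" and ?l = "pi_part (pi_compl {p}) n"
  have n: "n = ?q * ?l" using assms pi_part_mult_compl by metis
  have pos: "?q > 0" "?l > 0" using pi_part_pos assms by auto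
  have q: "pi_number {p} ?q" "pi_number (pi_compl {p}) ?l" using pi_number_pi_part assms by auto
  then have "pi_number (pi_compl \<pi>) ?q"
    using assms unfolding pi_number_def pi_compl_def by auto
  then have "pi_part \<pi> ?q = 1" by (rule pi_part_trivial)
  then have e: "pi_part \<pi> n = pi_part \<pi> ?l" using pi_part_mult[OF pos, of \<pi>] n by simp
  show "pi_number (insert p \<pi>) (?q * pi_part \<pi> n)"
    using q(1) pi_number_pi_part[OF assms(3), of \<pi>]
    by (intro pi_number_mult) (auto simp: pi_number_def)
  have "pi_number (pi_compl {p}) (pi_part (pi_compl \<pi>) ?l)"
    using q(2) pi_part_dvd pos pi_number_dvd by blast
  then show "pi_number (pi_compl (insert p \<pi>)) (pi_part (pi_compl \<pi>) ?l)"
    using pi_number_pi_part[OF pos(2), of "pi_compl \<pi>"] unfolding pi_number_def pi_compl_def by auto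
  show "n = ?q * pi_part \<pi> n * pi_part (pi_compl \<pi>) ?l"
    using n e pi_part_mult_compl[OF pos(2), of \<pi>] by (simp add: mult.assoc)
qed

lemma pi_number_singleton_prime_power:
  "Factorial_Ring.prime p \<Longrightarrow> pi_number {p} (p ^ a)"
  unfolding pi_number_def by (auto simp: prime_gt_0_nat dest: prime_dvd_power primes_dvd_imp_eq)

lemma pi_number_compl_singleton:
  "Factorial_Ring.prime p \<Longrightarrow> pi_number (pi_compl {p}) l \<longleftrightarrow> \<not> p dvd l"
  unfolding pi_number_def pi_compl_def by (cases "l = 0") auto

lemma pi_part_singleton:
  "Factorial_Ring.prime p \<Longrightarrow> \<not> p dvd l \<Longrightarrow> pi_part {p} (p ^ a * l) = p ^ a"
  using pi_part_eqI pi_number_singleton_prime_power pi_number_compl_singleton by blast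

section \<open>The sum of the element orders of a cyclic group as an arithmetic function\<close>

definition cyclic_order_sum :: "nat \<Rightarrow> nat" where
  "cyclic_order_sum m = (\<Sum>d | d dvd m. d * totient d)"

text \<open>\<open>m div gcd i m\<close> is the order of i in Z/m, so the sum over divisors turns
  into a sum over group elements.\<close>

lemma cyclic_order_sum_gcd:
  assumes "m > 0"
  shows "cyclic_order_sum m = (\<Sum>i\<in>{0<..m}. m div gcd i m)"
proof -
  define A where "A = (\<lambda>d. {k\<in>{0<..m}. gcd k m = d})"
  have "(\<Sum>i\<in>{0<..m}. m div gcd i m) = (\<Sum>d | d dvd m. \<Sum>i\<in>{i\<in>{0<..m}. gcd i m = d}. m div gcd i m)"
    using assms by (intro sum.group[symmetric]) auto
  also have "\<dots> = (\<Sum>d | d dvd m. m div d * totient (m div d))"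
  proof (rule sum.cong[OF refl])
    fix d assume "d \<in> {d. d dvd m}"
    then have "card {k\<in>{0<..m}. gcd k m = d} = totient (m div d)"
      using assms card_gcd_eq_totient by auto
    then show "(\<Sum>i\<in>{i\<in>{0<..m}. gcd i m = d}. m div gcd i m) = m div d * totient (m div d)" by simp
  qed
  also have "\<dots> = (\<Sum>d | d dvd m. d * totient d)" using assms
    by (intro sum.reindex_bij_witness[of _ "(div) m" "(div) m"]) (auto elim: dvdE)
  finally show ?thesis by (simp add: cyclic_order_sum_def)
qed

lemma cyclic_order_sum_pos: "m > 0 \<Longrightarrow> cyclic_order_sum m > 0"
  unfolding cyclic_order_sum_def by (rule sum_pos) auto

lemma sum_lessThan_periodic:
  fixes f :: "nat \<Rightarrow> nat"
  assumes "\<And>i. f (i + m) = f i"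
  shows "(\<Sum>i<m * k. f i) = k * (\<Sum>i<m. f i)"
proof (induction k)
  case (Suc k)
  have per: "f (i + m * k) = f i" for i
  proof (induction k)
    case (Suc k)
    have "f (i + m * Suc k) = f ((i + m * k) + m)" by (simp add: algebra_simps)
    then show ?case using Suc assms by metis
  qed simp
  have "(\<Sum>i<m * Suc k. f i) = (\<Sum>i=0..<m * k. f i) + (\<Sum>i=m * k..<m * k + m. f i)"
    by (simp add: lessThan_atLeast0 sum.atLeastLessThan_concat add.commute)
  also have "(\<Sum>i=m * k..<m * k + m. f i) = (\<Sum>i=0..<m. f (i + m * k))"
    using sum.shift_bounds_nat_ivl[of f 0 "m * k" m] by (simp add: add.commute)
  finally have "(\<Sum>i<m * Suc k. f i) = (\<Sum>i<m * k. f i) + (\<Sum>i<m. f (i + m * k))"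
    by (simp add: lessThan_atLeast0)
  then show ?case using Suc per by simp
qed simp

lemma cyclic_order_sum_gcd': "m > 0 \<Longrightarrow> cyclic_order_sum m = (\<Sum>i<m. m div gcd i m)"
proof -
  assume m: "m > 0"
  \<comment> \<open>The zero residue is represented by m on one side and by 0 on the other; both
    give the summand 1.\<close>
  have "{0<..m} = insert m {0<..<m}" "{..<m} = insert 0 {0<..<m}" using m by auto
  then show ?thesis using m by (simp add: cyclic_order_sum_gcd)
qed

text \<open>Reduction from Z/mk to Z/m has fibres of size k and does not increase orders. Strictness
  comes from the residue 1, whose order drops from mk to m.\<close>

lemma cyclic_order_sum_mult_le:
  assumes "m > 0" "k > 0"
  shows "k * cyclic_order_sum m \<le> cyclic_order_sum (m * k)"
    and "k > 1 \<Longrightarrow> k * cyclic_order_sum m < cyclic_order_sum (m * k)"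
proof -
  have per: "m div gcd (i + m) m = m div gcd i m" for i by simp
  have eq: "k * cyclic_order_sum m = (\<Sum>i<m * k. m div gcd i m)"
    using sum_lessThan_periodic[of "\<lambda>i. m div gcd i m", OF per] assms
    by (simp add: cyclic_order_sum_gcd')
  have eq2: "cyclic_order_sum (m * k) = (\<Sum>i<m * k. m * k div gcd i (m * k))"
    using assms by (simp add: cyclic_order_sum_gcd')
  have le: "m div gcd i m \<le> m * k div gcd i (m * k)" for i
  proof -
    have "gcd i (m * k) dvd gcd i m * k"
      by (metis dvd_triv_left gcd_dvd1 gcd_dvd2 gcd_greatest gcd_mult_distrib_nat mult.commute dvd_trans)
    moreover have "gcd i m * k > 0" using assms by simp
    ultimately have "m * k div (gcd i m * k) \<le> m * k div gcd i (m * k)"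
      by (intro div_le_mono2) (use assms in \<open>auto intro: dvd_imp_le\<close>)
    then show ?thesis using assms by simp
  qed
  show "k * cyclic_order_sum m \<le> cyclic_order_sum (m * k)"
    unfolding eq eq2 by (intro sum_mono le)
  assume k: "k > 1"
  show "k * cyclic_order_sum m < cyclic_order_sum (m * k)"
    unfolding eq eq2
  proof (rule sum_strict_mono_ex1)
    have "1 < m * k" using assms k by (metis One_nat_def Suc_lessI nat_mult_eq_1_iff nat_0_less_mult_iff less_irrefl)
    then show "\<exists>i\<in>{..<m * k}. m div gcd i m < m * k div gcd i (m * k)"
      using assms k by (intro bexI[of _ 1]) auto
  qed (use le in auto)
qed

lemma gcd_mult_coprime:
  fixes a b d :: nat
  assumes "coprime a b" "d dvd a * b"
  shows "gcd d a * gcd d b = d"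
proof (rule dvd_antisym)
  show "gcd d a * gcd d b dvd d"
    using assms(1) by (intro divides_mult) (auto intro: coprime_divisors[of _ a _ b])
  show "d dvd gcd d a * gcd d b"
    using assms(2) by (metis dvd_triv_left gcd_greatest gcd_mult_distrib_nat gcd.commute mult.commute dvd_mult dvd_mult2)
qed

text \<open>Divisors of a product of coprime factors correspond to pairs of divisors, recovered by
  gcds, and the totient is multiplicative on such pairs.\<close>

lemma cyclic_order_sum_prime_power_mult:
  assumes p: "Factorial_Ring.prime p" and l: "\<not> p dvd l" "l > 0"
  shows "cyclic_order_sum (p ^ a * l) = cyclic_order_sum (p ^ a) * cyclic_order_sum l"
proof -
  have cop: "coprime (p ^ i) d" if "d dvd l" for i d
    using p l that by (metis coprime_power_left_iff dvd_trans prime_imp_coprime)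
  have "cyclic_order_sum (p ^ a) * cyclic_order_sum l
      = (\<Sum>(i, j)\<in>{d. d dvd p ^ a} \<times> {d. d dvd l}. (i * totient i) * (j * totient j))"
    unfolding cyclic_order_sum_def by (simp add: sum_product sum.cartesian_product)
  also have "\<dots> = (\<Sum>d | d dvd p ^ a * l. d * totient d)"
  proof (rule sum.reindex_bij_witness[of _ "\<lambda>d. (gcd d (p ^ a), gcd d l)" "\<lambda>(i, j). i * j"])
    fix x assume x: "x \<in> {d. d dvd p ^ a} \<times> {d. d dvd l}"
    obtain i j where ij: "x = (i, j)" "i dvd p ^ a" "j dvd l" using x by (cases x) auto
    obtain b where b: "i = p ^ b" using ij p by (metis divides_primepow_nat)
    have c: "coprime i j" "coprime i l" "coprime j (p ^ a)"
      using b cop ij by (auto simp: coprime_commute)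
    have "gcd (i * j) (p ^ a) = gcd i (p^a)" "gcd (i * j) l = gcd j l"
      using c by (simp_all add: gcd_mult_left_right_cancel gcd_mult_left_left_cancel coprime_commute)
    then show "(\<lambda>d. (gcd d (p ^ a), gcd d l)) (case x of (i, j) \<Rightarrow> i * j) = x"
      using ij by (simp add: gcd_proj1_iff)
    show "(case x of (i, j) \<Rightarrow> i * j) \<in> {d. d dvd p ^ a * l}" using ij by (auto intro: mult_dvd_mono)
    show "(case x of (i, j) \<Rightarrow> i * j) * totient (case x of (i, j) \<Rightarrow> i * j) =
         (case x of (i, j) \<Rightarrow> i * totient i * (j * totient j))"
      using ij c by (simp add: totient_mult_coprime)
  next
    fix d assume "d \<in> {d. d dvd p ^ a * l}"
    then have d: "d dvd p ^ a * l" by simp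
    show "(case (gcd d (p ^ a), gcd d l) of (i, j) \<Rightarrow> i * j) = d"
      using d cop[of l a] by (simp add: gcd_mult_coprime)
  qed auto
  finally show ?thesis by (simp add: cyclic_order_sum_def)
qed

text \<open>Passing from a to a+1 adds p^(2a+1)(p-1). The factor p+1 clears the denominator of the
  geometric sum.\<close>

lemma cyclic_order_sum_prime_power:
  assumes p: "Factorial_Ring.prime p"
  shows "(p + 1) * cyclic_order_sum (p ^ a) = p ^ (2 * a + 1) + 1"
proof (induction a)
  case 0 then show ?case by (simp add: cyclic_order_sum_def)
next
  case (Suc a)
  have "{d. d dvd p ^ Suc a} = insert (p ^ Suc a) {d. d dvd p ^ a}"
    using p by (auto simp: divides_primepow_nat le_Suc_eq simp del: power_Suc)
  moreover have "p ^ Suc a \<notin> {d. d dvd p ^ a}"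
    using p prime_gt_1_nat[OF p] by (auto dest!: power_dvd_imp_le)
  moreover have "finite {d. d dvd p ^ a}" using prime_gt_0_nat[OF p] by simp
  ultimately have "cyclic_order_sum (p ^ Suc a) = p ^ Suc a * (p ^ a * (p - 1)) + cyclic_order_sum (p ^ a)"
    unfolding cyclic_order_sum_def using totient_prime_power_Suc[OF p, of a] by simp
  then have "(p + 1) * cyclic_order_sum (p ^ Suc a) =
      (p + 1) * (p - 1) * (p ^ Suc a * p ^ a) + (p + 1) * cyclic_order_sum (p ^ a)"
    by (simp only: distrib_left[of "p + 1"]) (simp only: ac_simps)
  also note Suc
  also have "(p + 1) * (p - 1) * (p ^ Suc a * p ^ a) = (p * p - 1) * p ^ (2 * a + 1)"
  proof -
    have "(p + 1) * (p - 1) = p * p - 1" by (cases p) auto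
    moreover have "p ^ Suc a * p ^ a = p ^ (2 * a + 1)" by (simp add: mult_2 power_add)
    ultimately show ?thesis by simp
  qed
  also have "(p * p - 1) * p ^ (2 * a + 1) + (p ^ (2 * a + 1) + 1) = (p * p) * p ^ (2 * a + 1) + 1"
    using prime_gt_0_nat[OF p] by (cases p) (auto simp: algebra_simps)
  also have "\<dots> = p ^ (2 * Suc a + 1) + 1" by simp
  finally show ?case .
qed

section \<open>Lower bounds for the totient and for the cyclic order sum\<close>

lemma prod_le_prod_subset:
  fixes f :: "'a \<Rightarrow> real"
  assumes "finite B" "A \<subseteq> B" "\<And>x. x \<in> B \<Longrightarrow> 0 \<le> f x \<and> f x \<le> 1"
  shows "prod f B \<le> prod f A"
proof -
  have "prod f B = prod f A * prod f (B - A)"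
    using assms by (simp add: prod.subset_diff mult.commute)
  also have "\<dots> \<le> prod f A * 1"
    using assms by (intro mult_left_mono prod_le_1 prod_nonneg) auto
  finally show ?thesis by simp
qed

text \<open>All factors 1 - 1/q lie in [0,1], so their product over the prime divisors of m is at
  least the product over all integers q from 2 to p, which telescopes to 1/p.\<close>

lemma le_mult_totient:
  assumes m: "m > 0" and p: "p > 0" and le: "\<And>q. Factorial_Ring.prime q \<Longrightarrow> q dvd m \<Longrightarrow> q \<le> p"
  shows "m \<le> p * totient m"
proof -
  have sub: "prime_factors m \<subseteq> {2..p}"
    using le prime_ge_2_nat by (auto simp: in_prime_factors_iff)
  have tel: "(\<Prod>q\<in>{2..p}. 1 - 1 / real q) = 1 / real p"
    using p
  proof (induction p rule: nat_induct_non_zero)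
    case (Suc n)
    then show ?case by (simp add: field_simps)
  qed simp
  have "1 / real p \<le> (\<Prod>q\<in>prime_factors m. 1 - 1 / real q)"
    unfolding tel[symmetric] using sub
    by (intro prod_le_prod_subset) (auto simp: field_simps)
  then have "real m * (1 / real p) \<le> real (totient m)"
    unfolding totient_formula2 by (intro mult_left_mono) auto
  then have "real m \<le> real (p * totient m)" using p by (simp add: field_simps)
  then show ?thesis by linarith
qed

text \<open>The generators contribute \<open>m * totient m\<close>, and the identity adds 1.\<close>

lemma cyclic_order_sum_gt:
  assumes "m > 1"
  shows "m * totient m < cyclic_order_sum m"
proof -
  have "(\<Sum>d\<in>{1, m}. d * totient d) \<le> cyclic_order_sum m"
    unfolding cyclic_order_sum_def using assms by (intro sum_mono2) auto
  then show ?thesis using assms by simp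
qed

section \<open>Orders of \<open>\<pi>\<close>-parts and groups with a cyclic Hall complement\<close>

text \<open>The value of \<open>psi\<close> on the cyclic group of order n: only the \<pi>-component
  of an element counts, and each one occurs together with every \<pi>'-component.\<close>

definition cyclic_psi :: "nat set \<Rightarrow> nat \<Rightarrow> nat" where
  "cyclic_psi \<pi> n = pi_part (pi_compl \<pi>) n * cyclic_order_sum (pi_part \<pi> n)"

lemma ord_subgroup:
  assumes "group G" "subgroup H G"
  shows "group.ord (G\<lparr>carrier := H\<rparr>) x = group.ord G x"
proof -
  interpret group G by fact
  show ?thesis
    using group.ord_def[OF subgroup_imp_group[OF assms(2)]] ord_def
    by (simp add: nat_pow_consistent[symmetric])
qed

text \<open>In a group of order n, raising to e gives the \<pi>-part and raising to f the
  \<pi>'-part of an element. The exponents depend on n only, so one pair serves the whole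
  group.\<close>

lemma pi_exponents:
  assumes "n > 0"
  obtains e f :: nat where "[e = 1] (mod pi_part \<pi> n)" "pi_part (pi_compl \<pi>) n dvd e"
    "[f = 1] (mod pi_part (pi_compl \<pi>) n)" "pi_part \<pi> n dvd f" "[e + f = 1] (mod n)"
proof -
  let ?m = "pi_part \<pi> n" and ?k = "pi_part (pi_compl \<pi>) n"
  have cop: "coprime ?m ?k" using coprime_pi_parts[OF assms] .
  obtain e where e: "[e = 1] (mod ?m)" "[e = 0] (mod ?k)"
    using binary_chinese_remainder_nat[OF cop] by blast
  obtain f where f: "[f = 0] (mod ?m)" "[f = 1] (mod ?k)"
    using binary_chinese_remainder_nat[OF cop] by blast
  have "[e + f = 1 + 0] (mod ?m)" "[e + f = 0 + 1] (mod ?k)"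
    using cong_add[OF e(1) f(1)] cong_add[OF e(2) f(2)] by auto
  then have "[e + f = 1] (mod ?m * ?k)"
    using cop by (auto intro: coprime_cong_mult_nat)
  then show ?thesis using that e f pi_part_mult_compl[OF assms, of \<pi>] by (simp add: cong_0_iff)
qed

context group
begin

text \<open>e is a multiple of the \<pi>'-part of \<open>ord x\<close> and coprime to its
  \<pi>-part, so the power removes exactly the former from the order.\<close>

lemma ord_pow_pi_part:
  assumes "finite (carrier G)" "x \<in> carrier G"
    and e: "[e = 1] (mod pi_part \<pi> (order G))" "pi_part (pi_compl \<pi>) (order G) dvd e"
  shows "ord (x [^] e) = pi_part \<pi> (ord x)"
proof -
  let ?d = "pi_part \<pi> (ord x)" and ?f = "pi_part (pi_compl \<pi>) (ord x)"
  have pos: "ord x > 0" "order G > 0"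
    using ord_ge_1[OF assms(1,2)] assms(1) by (auto simp: order_gt_0_iff_finite)
  have "?d dvd pi_part \<pi> (order G)" "?f dvd pi_part (pi_compl \<pi>) (order G)"
    using pi_part_dvd_mono ord_dvd_group_order assms(2) pos by auto
  then have f: "?f dvd e" and d: "[e = 1] (mod ?d)"
    using e cong_dvd_modulus_nat dvd_trans by blast+
  then have d: "coprime ?d e" using cong_imp_coprime cong_sym coprime_1_left coprime_commute by metis
  have df: "ord x = ?d * ?f" "coprime ?d ?f"
    using pi_part_mult_compl coprime_pi_parts pos by metis+
  have "(x [^] e) [^] i = \<one> \<longleftrightarrow> ?d dvd i" for i :: nat
  proof -
    have "(x [^] e) [^] i = \<one> \<longleftrightarrow> ?d * ?f dvd e * i"
      using assms(2) df(1) by (simp add: nat_pow_pow pow_eq_id)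
    also have "\<dots> \<longleftrightarrow> ?d dvd e * i \<and> ?f dvd e * i"
      using df(2) by (metis divides_mult dvd_mult_left dvd_mult_right)
    also have "\<dots> \<longleftrightarrow> ?d dvd i"
      using f d by (simp add: coprime_dvd_mult_right_iff)
    finally show ?thesis .
  qed
  then show ?thesis using ord_unique[of "x [^] e" ?d] assms(2) by simp
qed

lemma elem_pi_part_eq:
  assumes "finite (carrier G)" "x \<in> carrier G"
    and e: "[e = 1] (mod pi_part \<pi> (order G))" "pi_part (pi_compl \<pi>) (order G) dvd e"
  shows "elem_pi_part G \<pi> x = x [^] e"
  unfolding elem_pi_part_def
proof (rule the_equality)
  let ?m = "pi_part \<pi> (order G)" and ?k = "pi_part (pi_compl \<pi>) (order G)"
  have n: "order G > 0" using assms(1) by (simp add: order_gt_0_iff_finite)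
  have pos: "ord x > 0" using ord_ge_1[OF assms(1,2)] by simp
  obtain f where f: "[f = 1] (mod ?k)" "?m dvd f" using pi_exponents[OF n] by metis
  have f': "pi_part (pi_compl (pi_compl \<pi>)) (order G) dvd f"
    using f(2) unfolding pi_part_def[of "pi_compl (pi_compl \<pi>)"] pi_compl_compl pi_part_def[of \<pi>] by simp
  have "[e + f = 1 + 0] (mod ?m)" "[e + f = 0 + 1] (mod ?k)"
    using cong_add[OF e(1), of f 0] cong_add[OF _ f(1), of e 0] e(2) f(2) by (auto simp: cong_0_iff)
  then have "[e + f = 1] (mod order G)"
    using coprime_cong_mult_nat coprime_pi_parts[OF n] pi_part_mult_compl[OF n, of \<pi>] by (metis add_0 add.right_neutral)
  then have "[int (e + f) = int 1] (mod int (ord x))"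
    using ord_dvd_group_order[OF assms(2)] cong_dvd_modulus_nat cong_int_iff by blast
  then have "x [^] int (e + f) = x [^] int 1"
    using assms(2) int_pow_eq by (metis cong_iff_dvd_diff cong_sym)
  then have "x [^] (e + f) = x" using assms(2) by (simp add: int_pow_int del: of_nat_add)
  then have ef: "x [^] e \<otimes> x [^] f = x" using assms(2) by (simp add: nat_pow_mult)
  then have fe: "x [^] f \<otimes> x [^] e = x" using assms(2) by (metis nat_pow_comm)
  have "pi_number \<pi> (ord (x [^] e))" "pi_number (pi_compl \<pi>) (ord (x [^] f))"
    using ord_pow_pi_part[OF assms] ord_pow_pi_part[OF assms(1,2) f(1) f'] pi_number_pi_part pos by auto
  then show "x [^] e \<in> carrier G \<and> (\<exists>v\<in>carrier G. x = x [^] e \<otimes> v \<and> x = v \<otimes> x [^] e \<and>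
          pi_number \<pi> (ord (x [^] e)) \<and> pi_number (pi_compl \<pi>) (ord v))"
    using ef fe assms(2) by (metis nat_pow_closed)
  \<comment> \<open>Uniqueness: in any such factorisation \<open>ord u\<close> divides the
    \<pi>-part and \<open>ord v\<close> the \<pi>'-part of the group order, so raising x = uv to e
    fixes u and kills v.\<close>
  fix u assume "u \<in> carrier G \<and> (\<exists>v\<in>carrier G. x = u \<otimes> v \<and> x = v \<otimes> u \<and>
             pi_number \<pi> (ord u) \<and> pi_number (pi_compl \<pi>) (ord v))"
  then obtain v where uv: "u \<in> carrier G" "v \<in> carrier G" "x = u \<otimes> v" "u \<otimes> v = v \<otimes> u"
     "pi_number \<pi> (ord u)" "pi_number (pi_compl \<pi>) (ord v)" by auto
  have "ord u dvd ?m * ?k" "ord v dvd ?m * ?k"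
    using uv ord_dvd_group_order pi_part_mult_compl[OF n, of \<pi>] by auto
  moreover have "coprime (ord u) ?k" "coprime (ord v) ?m"
    using uv pi_number_coprime pi_number_pi_part[OF n] using coprime_commute by blast+
  ultimately have d: "ord u dvd ?m" "ord v dvd ?k"
    by (simp_all add: coprime_dvd_mult_left_iff coprime_dvd_mult_right_iff)
  then have "[int e = int 1] (mod int (ord u))"
    using e(1) cong_dvd_modulus_nat cong_int_iff by blast
  then have "u [^] int e = u [^] int 1"
    using uv(1) int_pow_eq by (metis cong_iff_dvd_diff cong_sym)
  then have "u [^] e = u" using uv(1) by (simp add: int_pow_int del: of_nat_1)
  moreover have "v [^] e = \<one>" using d e(2) uv(2) pow_eq_id dvd_trans by blast
  ultimately show "u = x [^] e" using uv by (simp add: pow_mult_distrib)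
qed

lemma psi_eq_sum:
  assumes "finite (carrier G)"
  shows "psi \<pi> G = (\<Sum>x\<in>carrier G. pi_part \<pi> (ord x))"
proof -
  have "order G > 0" using assms(1) by (simp add: order_gt_0_iff_finite)
  then obtain e where "[e = 1] (mod pi_part \<pi> (order G))" "pi_part (pi_compl \<pi>) (order G) dvd e"
    using pi_exponents by metis
  then show ?thesis unfolding psi_def
    using assms elem_pi_part_eq ord_pow_pi_part by (intro sum.cong) auto
qed

lemma psi_subgroup_eq_sum:
  assumes "finite (carrier G)" "subgroup H G"
  shows "psi \<pi> (G\<lparr>carrier := H\<rparr>) = (\<Sum>x\<in>H. pi_part \<pi> (ord x))"
proof -
  interpret H: group "G\<lparr>carrier := H\<rparr>" using subgroup_imp_group[OF assms(2)] .
  have "finite H" using assms finite_subset subgroup.subset by metis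
  then show ?thesis using H.psi_eq_sum ord_subgroup[OF is_group assms(2)] by simp
qed

lemma ord_mult_coprime:
  assumes "x \<in> carrier G" "y \<in> carrier G" "x \<otimes> y = y \<otimes> x" "coprime (ord x) (ord y)"
  shows "ord (x \<otimes> y) = ord x * ord y"
proof (rule dvd_antisym)
  show "ord (x \<otimes> y) dvd ord x * ord y" using ord_mul_divides assms by blast
  have *: "ord a dvd ord (a \<otimes> b)"
    if "a \<in> carrier G" "b \<in> carrier G" "a \<otimes> b = b \<otimes> a" "coprime (ord a) (ord b)" for a b
  proof -
    let ?N = "ord (a \<otimes> b)"
    have "(a \<otimes> b) [^] (?N * ord b) = \<one>" using that pow_eq_id by simp
    then have "a [^] (?N * ord b) \<otimes> b [^] (?N * ord b) = \<one>" using that pow_mult_distrib by metis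
    moreover have "b [^] (?N * ord b) = \<one>" using that pow_eq_id by simp
    ultimately have "a [^] (?N * ord b) = \<one>" using that by simp
    then have "ord a dvd ?N * ord b" using that pow_eq_id by blast
    then show ?thesis using that(4) coprime_dvd_mult_left_iff by blast
  qed
  have "ord x dvd ord (x \<otimes> y)" "ord y dvd ord (x \<otimes> y)"
    using *[of x y] *[of y x] assms by (auto simp: coprime_commute)
  then show "ord x * ord y dvd ord (x \<otimes> y)" using assms divides_mult by blast
qed

section \<open>Normal Hall subgroups with a cyclic complement\<close>

lemma pow_card_subgroup:
  assumes "subgroup H G" "h \<in> H" shows "h [^] card H = \<one>"
proof -
  interpret H: group "G\<lparr>carrier := H\<rparr>" using subgroup_imp_group[OF assms(1)] .
  show ?thesis using H.pow_order_eq_1 assms(2) nat_pow_consistent unfolding order_def by simp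
qed

text \<open>Modulo H the powers of hc are those of c; moving a power of c past h costs a
  conjugation, which normality absorbs.\<close>

lemma normal_mult_pow:
  assumes "H \<lhd> G" "h \<in> H" "c \<in> carrier G"
  shows "\<exists>h'\<in>H. (h \<otimes> c) [^] (t::nat) = h' \<otimes> c [^] t"
proof (induction t)
  interpret normal H G by fact
  case 0
  then show ?case using subgroup.one_closed[OF subgroup_axioms] by force
next
  interpret normal H G by fact
  case (Suc t)
  then obtain h' where h': "h' \<in> H" "(h \<otimes> c) [^] t = h' \<otimes> c [^] t" by blast
  have hc: "h \<in> carrier G" "h' \<in> carrier G" using h' assms subset by auto
  have "c [^] t \<otimes> h \<otimes> inv (c [^] t) \<in> H" using inv_op_closed2 assms by simp
  then have "h' \<otimes> (c [^] t \<otimes> h \<otimes> inv (c [^] t)) \<in> H" using h' by simp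
  moreover have "(h \<otimes> c) [^] Suc t = h' \<otimes> (c [^] t \<otimes> h \<otimes> inv (c [^] t)) \<otimes> c [^] Suc t"
    using h' hc assms(3) by (simp add: m_assoc inv_solve_left')
      (metis assms(3) inv_closed l_inv l_one m_assoc m_closed nat_pow_closed)
  ultimately show ?case by blast
qed

lemma normal_hall_product:
  assumes fin: "finite (carrier G)" and H: "H \<lhd> G" and c: "c \<in> carrier G"
    and cop: "coprime (card H) (ord c)" and ord: "order G = card H * ord c"
  shows "bij_betw (\<lambda>(h, i). h \<otimes> c [^] i) (H \<times> {..<ord c}) (carrier G)"
proof -
  interpret normal H G by fact
  have 1: "c [^] i \<in> H \<Longrightarrow> c [^] i = \<one>" for i :: int
  proof -
    assume "c [^] i \<in> H"
    then have "(c [^] i) [^] card H = \<one>" using pow_card_subgroup subgroup_axioms by blast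
    moreover have "(c [^] i) [^] int (ord c) = \<one>" using c by (simp add: int_pow_pow int_pow_eq_id)
    then have "(c [^] i) [^] ord c = \<one>" by (simp add: int_pow_int)
    ultimately have "ord (c [^] i) dvd card H" "ord (c [^] i) dvd ord c" using c pow_eq_id by auto
    then have "ord (c [^] i) = 1" using cop by (metis coprime_common_divisor_nat)
    then show ?thesis using c ord_eq_1 by simp
  qed
  have inj: "inj_on (\<lambda>(h, i). h \<otimes> c [^] i) (H \<times> {..<ord c})"
  proof (rule inj_onI, clarsimp)
    fix h h' i j assume a: "h \<in> H" "h' \<in> H" "i < ord c" "j < ord c" "h \<otimes> c [^] i = h' \<otimes> c [^] j"
    have hc: "h \<in> carrier G" "h' \<in> carrier G" using a subset by auto
    have "inv h' \<otimes> h = c [^] j \<otimes> inv (c [^] i)"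
    proof -
      have "h = h \<otimes> c [^] i \<otimes> inv (c [^] i)" using hc c by (simp add: m_assoc)
      also have "\<dots> = h' \<otimes> (c [^] j \<otimes> inv (c [^] i))" using a(5) hc c by (simp add: m_assoc)
      finally have "inv h' \<otimes> h = inv h' \<otimes> (h' \<otimes> (c [^] j \<otimes> inv (c [^] i)))" by simp
      then show ?thesis using hc c by (simp flip: m_assoc)
    qed
    also have "\<dots> = c [^] (int j - int i)" using c by (simp add: int_pow_diff int_pow_int)
    finally have eq: "inv h' \<otimes> h = c [^] (int j - int i)" .
    moreover have "inv h' \<otimes> h \<in> H" using a by simp
    ultimately have "c [^] (int j - int i) = \<one>" using 1 by metis
    then have "int (ord c) dvd int j - int i" using c int_pow_eq_id by blast
    then have "i = j" using a(3,4) by (metis mod_eq_dvd_iff mod_less of_nat_eq_iff zmod_int)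
    moreover from this have "h = h'" using eq c hc by (metis inv_equality inv_inv diff_self int_pow_0 inv_closed)
    ultimately show "h = h' \<and> i = j" by simp
  qed
  have "(\<lambda>(h, i). h \<otimes> c [^] i) ` (H \<times> {..<ord c}) \<subseteq> carrier G" using c subset by auto
  moreover have "card ((\<lambda>(h, i). h \<otimes> c [^] i) ` (H \<times> {..<ord c})) = card (carrier G)"
    using card_image[OF inj] ord by (simp add: order_def card_cartesian_product)
  ultimately show ?thesis using inj fin unfolding bij_betw_def by (metis card_subset_eq)
qed

text \<open>The orders of \<open>h \<otimes> c [^] i\<close> and of \<open>c [^] i\<close> differ by
  a \<pi>'-factor only, so the \<pi>-part depends on i alone and each i occurs |H| times. One
  computation thus yields the converse direction of the equality case and the value for the cyclic
  group.\<close>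

lemma psi_eq_cyclic_psi:
  assumes fin: "finite (carrier G)" and H: "H \<lhd> G" and c: "c \<in> carrier G"
    and cH: "card H = pi_part (pi_compl \<pi>) (order G)" and oc: "ord c = pi_part \<pi> (order G)"
  shows "psi \<pi> G = cyclic_psi \<pi> (order G)"
proof -
  interpret normal H G by fact
  let ?m = "pi_part \<pi> (order G)" and ?k = "pi_part (pi_compl \<pi>) (order G)"
  have n: "order G > 0" using fin by (simp add: order_gt_0_iff_finite)
  have cop: "coprime ?m ?k" using coprime_pi_parts[OF n] .
  have pm: "pi_number \<pi> ?m" "pi_number (pi_compl \<pi>) ?k" using pi_number_pi_part[OF n] by auto
  have bij: "bij_betw (\<lambda>(h, i). h \<otimes> c [^] i) (H \<times> {..<?m}) (carrier G)"
    using normal_hall_product[OF fin H c] cop n cH oc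
    by (metis coprime_commute mult.commute pi_part_mult_compl)
  have oi: "ord (c [^] i) = ?m div gcd i ?m" for i :: nat
    using ord_pow_gen[OF c, of i] oc pi_part_pos[OF n, of \<pi>] by (simp add: gcd.commute)
  have part: "pi_part \<pi> (ord (h \<otimes> c [^] i)) = ?m div gcd i ?m" if h: "h \<in> H" for h i
  proof -
    let ?x = "h \<otimes> c [^] i" and ?o = "ord (c [^] i)"
    have x: "?x \<in> carrier G" using h c subset by auto
    have om: "?o dvd ?m" unfolding oi by (metis div_dvd_div dvd_def dvd_mult_div_cancel gcd_dvd2 mult.commute)
    \<comment> \<open>Upper bound for \<open>ord ?x\<close>: the power \<open>?o\<close> of
      \<open>?x\<close> lies in H and is killed by \<open>?k\<close>. The lower bound follows in the
      same way, since the power \<open>ord ?x\<close> of \<open>c [^] i\<close> lies in H and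
      \<open>?o\<close> is prime to \<open>?k\<close>.\<close>
    obtain h' where h': "h' \<in> H" "?x [^] ?o = h' \<otimes> (c [^] i) [^] ?o"
      using normal_mult_pow[OF H h, of "c [^] i" ?o] c by auto
    then have "?x [^] ?o = h'" using c subset by auto
    then have "(?x [^] ?o) [^] ?k = \<one>" using pow_card_subgroup[OF subgroup_axioms] h' cH by metis
    then have d1: "ord ?x dvd ?o * ?k" using x by (simp add: nat_pow_pow pow_eq_id)
    obtain h'' where h'': "h'' \<in> H" "?x [^] ord ?x = h'' \<otimes> (c [^] i) [^] ord ?x"
      using normal_mult_pow[OF H h, of "c [^] i" "ord ?x"] c by auto
    let ?y = "(c [^] i) [^] ord ?x"
    have "h'' \<otimes> ?y = \<one>" using h'' x by simp
    then have "?y = inv h''" using h''(1) c subset by (metis inv_closed inv_equality inv_inv nat_pow_closed subsetD)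
    then have "?y \<in> H" using h'' by simp
    then have "?y [^] ?k = \<one>" using pow_card_subgroup[OF subgroup_axioms] cH by metis
    then have "(c [^] i) [^] (ord ?x * ?k) = \<one>" using nat_pow_pow[of "c [^] i"] c by (metis nat_pow_closed)
    then have "?o dvd ord ?x * ?k" using c pow_eq_id[of "c [^] i"] by blast
    moreover have "coprime ?o ?k" using om cop by (meson coprime_divisors dvd_refl)
    ultimately have "?o dvd ord ?x" by (simp add: coprime_dvd_mult_left_iff)
    then obtain f where f: "ord ?x = ?o * f" by blast
    then have "f dvd ?k" using d1 n om pi_part_pos[OF n, of \<pi>] by (metis dvd_mult_cancel dvd_pos_nat)
    then have "pi_part \<pi> (ord ?x) = ?o"
      using f pi_part_eqI pi_number_dvd pm om by blast
    then show ?thesis using oi by simp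
  qed
  have "psi \<pi> G = (\<Sum>x\<in>carrier G. pi_part \<pi> (ord x))" using psi_eq_sum[OF fin] .
  also have "\<dots> = (\<Sum>(h, i)\<in>H \<times> {..<?m}. ?m div gcd i ?m)"
    using part by (intro sum.reindex_bij_betw[OF bij, symmetric, THEN trans] sum.cong) auto
  also have "\<dots> = card H * cyclic_order_sum ?m"
    using cyclic_order_sum_gcd'[of ?m] pi_part_pos[OF n] by (simp add: sum.cartesian_product[symmetric])
  finally show ?thesis unfolding cyclic_psi_def cH .
qed

end

lemma psi_integer_mod_group:
  assumes "n > 0"
  shows "psi \<pi> (integer_mod_group n) = cyclic_psi \<pi> n"
proof -
  let ?Z = "integer_mod_group n" and ?m = "pi_part \<pi> n" and ?k = "pi_part (pi_compl \<pi>) n"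
  interpret comm_group ?Z by simp
  have fin: "finite (carrier ?Z)" and o: "order ?Z = n"
    using assms by (auto simp: carrier_integer_mod_group order_def)
  \<comment> \<open>The reduction matters for n = 1, where the generator is 0.\<close>
  define g where "g = 1 mod int n"
  have g: "g \<in> carrier ?Z" using assms by (auto simp: g_def carrier_integer_mod_group)
  have "g [^]\<^bsub>?Z\<^esub> i = \<one>\<^bsub>?Z\<^esub> \<longleftrightarrow> n dvd i" for i :: nat
    by (simp add: g_def mod_mult_right_eq flip: dvd_eq_mod_eq_0)
  then have og: "ord g = n" using ord_unique[OF g] by blast
  have mk: "?m * ?k = n" "?m > 0" "?k > 0" using pi_part_mult_compl[OF assms] pi_part_pos[OF assms] by auto
  let ?H = "generate ?Z {g [^]\<^bsub>?Z\<^esub> ?m}"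
  have "subgroup ?H ?Z" using nat_pow_closed[OF g] by (intro generate_is_subgroup) (auto simp del: pow_integer_mod_group)
  then have H: "?H \<lhd> ?Z" by (rule subgroup_imp_normal)
  have "ord (g [^]\<^bsub>?Z\<^esub> ?m) = ?k" "ord (g [^]\<^bsub>?Z\<^esub> ?k) = ?m"
    using ord_pow[OF g, of ?m] ord_pow[OF g, of ?k] og mk
    by (metis dvd_triv_left dvd_triv_right less_irrefl nonzero_mult_div_cancel_left nonzero_mult_div_cancel_right)+
  then show ?thesis using psi_eq_cyclic_psi[OF fin H nat_pow_closed[OF g], of \<pi> ?k] o
      generate_pow_card[OF nat_pow_closed[OF g], of ?m] by (simp del: pow_integer_mod_group)
qed

section \<open>Cyclic Sylow subgroups and the transfer\<close>

text \<open>By periodicity the iterates of \<sigma> act on A like a cyclic group of order p^b, so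
  orbit lengths are powers of p; without a fixed point each of them, and hence |A|, would be
  divisible by p.\<close>

lemma prime_power_period_fixed_point:
  assumes p: "Factorial_Ring.prime p" and fin: "finite A"
    and maps: "\<And>x. x \<in> A \<Longrightarrow> \<sigma> x \<in> A"
    and per: "\<And>x. x \<in> A \<Longrightarrow> (\<sigma> ^^ (p ^ b)) x = x"
    and ndvd: "\<not> p dvd card A"
  shows "\<exists>x\<in>A. \<sigma> x = x"
proof (rule ccontr)
  assume nofix: "\<not> (\<exists>x\<in>A. \<sigma> x = x)"
  have q: "p ^ b > 0" using p by (simp add: prime_gt_0_nat)
  have maps': "x \<in> A \<Longrightarrow> (\<sigma> ^^ i) x \<in> A" for x i by (induction i) (auto intro: maps)
  define r where "r = {(x, y). x \<in> A \<and> (\<exists>i. y = (\<sigma> ^^ i) x)}"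
  have add: "(\<sigma> ^^ i) ((\<sigma> ^^ j) x) = (\<sigma> ^^ (i + j)) x" for i j x by (simp add: funpow_add)
  have per': "(\<sigma> ^^ (i * p ^ b)) x = x" if "x \<in> A" for x i
    by (induction i) (auto simp: funpow_add per that)
  have "equiv A r"
  proof (rule equivI)
    show "r \<subseteq> A \<times> A" using maps' by (auto simp: r_def)
    show "refl_on A r" by (auto simp: refl_on_def r_def intro: exI[of _ 0])
    show "sym r"
    proof (rule symI)
      fix x y assume "(x, y) \<in> r"
      then obtain i where i: "x \<in> A" "y = (\<sigma> ^^ i) x" by (auto simp: r_def)
      \<comment> \<open>Multiples of p^b act trivially, so \<open>i * p ^ b - i\<close> further
        steps lead back from y to x; the bound makes the subtraction exact.\<close>
      have "i \<le> i * p ^ b" using q by (cases "p ^ b") auto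
      then have "i * p ^ b - i + i = i * p ^ b" by simp
      then have "(\<sigma> ^^ (i * p ^ b - i)) y = x" using i add per'[OF i(1), of i] by metis
      then have "\<exists>k. x = (\<sigma> ^^ k) y" by metis
      then show "(y, x) \<in> r" using i(1) maps' by (simp add: r_def i(2))
    qed
    show "trans r"
    proof (rule transI)
      fix x y z assume "(x, y) \<in> r" "(y, z) \<in> r"
      then obtain i j where "x \<in> A" "y = (\<sigma> ^^ i) x" "z = (\<sigma> ^^ j) y" by (auto simp: r_def)
      then show "(x, z) \<in> r" using add[of j i x] by (auto simp: r_def)
    qed
  qed
  moreover have "p dvd card B" if BA: "B \<in> A // r" for B
  proof -
    obtain x where x: "x \<in> A" "B = r `` {x}" using BA by (blast elim: quotientE)
    then have B: "B = range (\<lambda>i. (\<sigma> ^^ i) x)" by (auto simp: r_def)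
    define d where "d = (LEAST d. d > 0 \<and> (\<sigma> ^^ d) x = x)"
    have d: "d > 0" "(\<sigma> ^^ d) x = x"
      using LeastI[of "\<lambda>d. d > 0 \<and> (\<sigma> ^^ d) x = x" "p ^ b"] q per x(1) by (auto simp: d_def)
    have least: "d \<le> e" if "e > 0" "(\<sigma> ^^ e) x = x" for e
      using Least_le[of "\<lambda>d. d > 0 \<and> (\<sigma> ^^ d) x = x"] that by (auto simp: d_def)
    have mult: "(\<sigma> ^^ (i * d)) x = x" for i
      by (induction i) (auto simp: funpow_add d)
    have modd: "(\<sigma> ^^ i) x = (\<sigma> ^^ (i mod d)) x" for i
      by (metis add mult mod_mult_div_eq mult.commute)
    have "d dvd p ^ b"
    proof (rule ccontr)
      assume "\<not> d dvd p ^ b"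
      then have "p ^ b mod d > 0" "p ^ b mod d < d" using d by (auto simp: mod_greater_zero_iff_not_dvd)
      moreover have "(\<sigma> ^^ (p ^ b mod d)) x = x" using modd per x(1) by metis
      ultimately show False using least[of "p ^ b mod d"] by linarith
    qed
    moreover have "d \<noteq> 1" using d nofix x(1) by auto
    ultimately have "p dvd d" using p
      using divides_primepow_nat[OF p, of d b] by (metis dvd_power gr0I power_0)
    moreover have "B = (\<lambda>i. (\<sigma> ^^ i) x) ` {..<d}"
    proof
      show "B \<subseteq> (\<lambda>i. (\<sigma> ^^ i) x) ` {..<d}"
      proof
        fix y assume "y \<in> B"
        then obtain i where "y = (\<sigma> ^^ i) x" using B by blast
        then have "y = (\<sigma> ^^ (i mod d)) x" using modd[of i] by simp
        then show "y \<in> (\<lambda>i. (\<sigma> ^^ i) x) ` {..<d}" using d(1) by auto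
      qed
    qed (use B in blast)
    moreover have "inj_on (\<lambda>i. (\<sigma> ^^ i) x) {..<d}"
    proof (rule linorder_inj_onI')
      fix i j assume ij: "i \<in> {..<d}" "j \<in> {..<d}" "i < j"
      show "(\<sigma> ^^ i) x \<noteq> (\<sigma> ^^ j) x"
      proof
        assume "(\<sigma> ^^ i) x = (\<sigma> ^^ j) x"
        then have "(\<sigma> ^^ (d - j + i)) x = (\<sigma> ^^ (d - j + j)) x" by (metis add)
        then have "(\<sigma> ^^ (d - j + i)) x = x" using ij d by simp
        then show False using least[of "d - j + i"] ij by auto
      qed
    qed
    ultimately show "p dvd card B" by (simp add: card_image)
  qed
  ultimately have "p dvd card A" using equiv_imp_dvd_card[OF fin] by blast
  then show False using ndvd by blast
qed

locale cyclic_sylow = group G for G (structure) +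
  fixes w p a l
  assumes fin: "finite (carrier G)" and w [simp]: "w \<in> carrier G"
    and prime_p: "Factorial_Ring.prime p" and ord_w: "ord w = p ^ a"
    and order_G: "order G = p ^ a * l" and ndvd: "\<not> p dvd l" and a_pos: "a > 0"
begin

definition lcos :: "'a \<Rightarrow> 'a set" where "lcos x = range (\<lambda>i::int. x \<otimes> w [^] i)"
text \<open>The choice depends on the coset as a set only, so all its elements share one
  representative.\<close>

definition rep :: "'a \<Rightarrow> 'a" where "rep x = (SOME y. y \<in> lcos x)"
definition T :: "'a set" where "T = rep ` carrier G"
text \<open>A logarithm relative to the representative. Since w has order p^a it is meaningful
  modulo p^a only, hence the congruences in what follows.\<close>

definition expo :: "'a \<Rightarrow> int" where "expo x = (SOME i. x = rep x \<otimes> w [^] i)"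

lemma q_pos: "p ^ a > 0" using prime_p by (simp add: prime_gt_0_nat)

lemma lcos_mult [simp]: "x \<in> carrier G \<Longrightarrow> lcos (x \<otimes> w [^] (j::int)) = lcos x"
proof -
  assume x: "x \<in> carrier G"
  have "x \<otimes> w [^] i = x \<otimes> w [^] j \<otimes> w [^] (i - j)" for i :: int
    using x int_pow_mult[of w j "i - j"] by (simp add: m_assoc)
  moreover have "x \<otimes> w [^] j \<otimes> w [^] i = x \<otimes> w [^] (j + i)" for i :: int
    using x by (simp add: m_assoc int_pow_mult)
  ultimately show ?thesis unfolding lcos_def by (auto simp only: image_iff intro!: set_eqI)
qed

lemma rep_in_lcos: "x \<in> carrier G \<Longrightarrow> rep x \<in> lcos x"
proof -
  assume "x \<in> carrier G"
  then have "x \<in> lcos x" unfolding lcos_def by (auto simp: image_iff intro!: exI[of _ 0])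
  then show ?thesis unfolding rep_def by (rule someI)
qed

lemma rep_eq: "x \<in> carrier G \<Longrightarrow> \<exists>i::int. rep x = x \<otimes> w [^] i"
  using rep_in_lcos unfolding lcos_def by auto

lemma rep_closed [simp]: "x \<in> carrier G \<Longrightarrow> rep x \<in> carrier G"
  using rep_eq by fastforce

lemma rep_mult [simp]: "x \<in> carrier G \<Longrightarrow> rep (x \<otimes> w [^] (j::int)) = rep x"
  unfolding rep_def by simp

lemma expo_eq: "x \<in> carrier G \<Longrightarrow> x = rep x \<otimes> w [^] expo x"
proof -
  assume x: "x \<in> carrier G"
  obtain i :: int where "rep x = x \<otimes> w [^] i" using rep_eq x by blast
  then have "x = rep x \<otimes> w [^] (- i)" using x by (simp add: m_assoc flip: int_pow_mult)
  then show ?thesis unfolding expo_def by (rule someI)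
qed

lemma rep_rep: "x \<in> carrier G \<Longrightarrow> rep (rep x) = rep x"
  using rep_eq rep_mult by metis

lemma T_props: "t \<in> T \<Longrightarrow> t \<in> carrier G" "t \<in> T \<Longrightarrow> rep t = t" "x \<in> carrier G \<Longrightarrow> rep x \<in> T"
  unfolding T_def using rep_rep by auto

lemma finite_T [simp]: "finite T" unfolding T_def using fin by simp

lemma w_pow_eq: "w [^] (i::int) = w [^] (j::int) \<longleftrightarrow> [i = j] (mod int (p ^ a))"
  using int_pow_eq[of w i j] ord_w by (simp add: cong_iff_dvd_diff dvd_diff_commute)

lemma expo_cong: "x \<in> carrier G \<Longrightarrow> [expo (x \<otimes> w [^] j) = expo x + j] (mod int (p ^ a))"
proof -
  assume x: "x \<in> carrier G"
  have "rep x \<otimes> w [^] expo (x \<otimes> w [^] j) = x \<otimes> w [^] j"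
    using expo_eq[of "x \<otimes> w [^] j"] x by simp
  also have "\<dots> = rep x \<otimes> w [^] expo x \<otimes> w [^] j" using expo_eq[OF x] by simp
  also have "\<dots> = rep x \<otimes> w [^] (expo x + j)" using x by (simp add: m_assoc int_pow_mult)
  finally show ?thesis using x w_pow_eq by simp
qed

lemma card_coset_closed:
  assumes A: "A \<subseteq> carrier G" and closed: "\<And>x i. x \<in> A \<Longrightarrow> x \<otimes> w [^] (i::int) \<in> A"
  shows "card A = p ^ a * card (T \<inter> A)"
proof -
  let ?f = "\<lambda>(t, i). t \<otimes> w [^] int i"
  have "inj_on ?f ((T \<inter> A) \<times> {..<p ^ a})"
  proof (rule inj_onI, clarsimp)
    fix t t' and i j :: nat
    assume a: "t \<in> T" "t' \<in> T" "i < p ^ a" "j < p ^ a" "t \<otimes> w [^] int i = t' \<otimes> w [^] int j"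
    then have "rep (t \<otimes> w [^] int i) = rep (t' \<otimes> w [^] int j)" by simp
    then have t: "t = t'" using a T_props rep_mult by metis
    then have "w [^] int i = w [^] int j" using a T_props by simp
    then have "[i = j] (mod p ^ a)" using w_pow_eq cong_int_iff by blast
    then show "t = t' \<and> i = j" using t a cong_less_modulus_unique_nat by blast
  qed
  moreover have "?f ` ((T \<inter> A) \<times> {..<p ^ a}) = A"
  proof
    show "?f ` ((T \<inter> A) \<times> {..<p ^ a}) \<subseteq> A" using closed by auto
    show "A \<subseteq> ?f ` ((T \<inter> A) \<times> {..<p ^ a})"
    proof
      fix x assume x: "x \<in> A"
      then have xc: "x \<in> carrier G" using A by auto
      let ?i = "nat (expo x mod int (p ^ a))"
      have "int ?i = expo x mod int (p ^ a)" using q_pos by simp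
      then have "w [^] int ?i = w [^] expo x" using w_pow_eq by (simp add: cong_def)
      then have "x = rep x \<otimes> w [^] int ?i" using expo_eq[OF xc] by simp
      moreover have "?i < p ^ a" using q_pos by (simp add: nat_less_iff)
      moreover have "rep x \<in> T \<inter> A" using T_props xc x closed rep_eq by (metis IntI)
      ultimately show "x \<in> ?f ` ((T \<inter> A) \<times> {..<p ^ a})" by force
    qed
  qed
  ultimately show ?thesis
    by (metis card_cartesian_product card_image card_lessThan mult.commute)
qed

lemma card_T: "card T = l"
proof -
  have "T \<inter> carrier G = T" using T_props by auto
  then have "p ^ a * l = p ^ a * card T"
    using card_coset_closed[of "carrier G"] order_G unfolding order_def by simp
  then show ?thesis using q_pos by (metis mult_left_cancel less_irrefl)
qed

lemma bij_rep_mult: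
  assumes g: "g \<in> carrier G"
  shows "bij_betw (\<lambda>t. rep (g \<otimes> t)) T T"
proof -
  have "inj_on (\<lambda>t. rep (g \<otimes> t)) T"
  proof (rule inj_onI)
    fix t t' assume t: "t \<in> T" "t' \<in> T" "rep (g \<otimes> t) = rep (g \<otimes> t')"
    then have tc: "t \<in> carrier G" "t' \<in> carrier G" using T_props by auto
    obtain i j :: int where "g \<otimes> t \<otimes> w [^] i = g \<otimes> t' \<otimes> w [^] j"
      using rep_eq[of "g \<otimes> t"] rep_eq[of "g \<otimes> t'"] t(3) tc g by (metis m_closed)
    then have "t \<otimes> w [^] i = t' \<otimes> w [^] j" using g tc by (simp add: m_assoc)
    then have "rep t = rep t'" using tc rep_mult by metis
    then show "t = t'" using t T_props by simp
  qed
  moreover have "(\<lambda>t. rep (g \<otimes> t)) ` T \<subseteq> T" using g T_props by auto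
  ultimately show ?thesis unfolding bij_betw_def using endo_inj_surj[OF finite_T] by simp
qed

text \<open>Left translation permutes the cosets of <w>, so it preserves the sum over T of a
  function that is constant on cosets modulo m. Both the multiplicativity of the transfer and its
  independence of the logarithm rest on this.\<close>

lemma sum_translate_cong:
  assumes g: "g \<in> carrier G"
    and inv: "\<And>x j. x \<in> carrier G \<Longrightarrow> [h (x \<otimes> w [^] (j::int)) = h x] (mod m)"
  shows "[(\<Sum>t\<in>T. h (g \<otimes> t)) = (\<Sum>t\<in>T. h t)] (mod (m::int))"
proof -
  have "[h (g \<otimes> t) = h (rep (g \<otimes> t))] (mod m)" if "t \<in> T" for t
    using that rep_eq[of "g \<otimes> t"] inv[of "g \<otimes> t"] g T_props by (metis cong_sym m_closed)
  then have "[(\<Sum>t\<in>T. h (g \<otimes> t)) = (\<Sum>t\<in>T. h (rep (g \<otimes> t)))] (mod m)" by (intro cong_sum)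
  also have "(\<Sum>t\<in>T. h (rep (g \<otimes> t))) = (\<Sum>t\<in>T. h t)"
    by (rule sum.reindex_bij_betw[OF bij_rep_mult[OF g]])
  finally show ?thesis .
qed

text \<open>Left multiplication by v acts on the l cosets of <w> with trivial p^b-th iterate. As p
  does not divide l, some coset is fixed, which means that v is conjugate into <w>.\<close>

lemma conjugate_into_sylow:
  assumes v: "v \<in> carrier G" "v [^] (p ^ b) = \<one>"
  shows "\<exists>g\<in>carrier G. \<exists>j::int. v \<otimes> g = g \<otimes> w [^] j"
proof -
  let ?s = "\<lambda>t. rep (v \<otimes> t)"
  have s: "(?s ^^ i) t = rep (v [^] i \<otimes> t)" if t: "t \<in> T" for i t
  proof (induction i)
    case 0 then show ?case using t T_props by simp
  next
    case (Suc i)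
    have tc: "t \<in> carrier G" using t T_props by simp
    obtain j :: int where j: "rep (v [^] i \<otimes> t) = v [^] i \<otimes> t \<otimes> w [^] j"
      using rep_eq[of "v [^] i \<otimes> t"] v tc by auto
    have "(?s ^^ Suc i) t = rep (v \<otimes> (v [^] i \<otimes> t \<otimes> w [^] j))" using Suc j by simp
    also have "\<dots> = rep (v \<otimes> v [^] i \<otimes> t \<otimes> w [^] j)" using v tc by (simp add: m_assoc)
    also have "\<dots> = rep (v [^] Suc i \<otimes> t)"
      using v tc rep_mult[of "v \<otimes> v [^] i \<otimes> t" j] nat_pow_Suc2[of v i] by simp
    finally show ?case .
  qed
  obtain t where t: "t \<in> T" "?s t = t"
    using prime_power_period_fixed_point[OF prime_p finite_T, of ?s b] s v T_props card_T ndvd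
    by auto
  then have tc: "t \<in> carrier G" using T_props by simp
  obtain j :: int where "t = v \<otimes> t \<otimes> w [^] j" using rep_eq[of "v \<otimes> t"] t tc v by auto
  then have "t \<otimes> w [^] (- j) = v \<otimes> t \<otimes> w [^] j \<otimes> w [^] (- j)" by simp
  also have "\<dots> = v \<otimes> t" using v tc by (simp add: m_assoc flip: int_pow_mult)
  finally show ?thesis using tc by metis
qed

text \<open>The transfer into \<open>\<langle>w\<rangle>\<close>, written additively modulo \<open>p\<^sup>a\<close>: \<open>expo\<close> plays the role of a logarithm.\<close>

definition V :: "'a \<Rightarrow> int" where "V g = (\<Sum>t\<in>T. expo (g \<otimes> t) - expo t)"

lemma V_mult:
  assumes "g \<in> carrier G" "h \<in> carrier G"
  shows "[V (g \<otimes> h) = V g + V h] (mod int (p ^ a))"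
proof -
  let ?F = "\<lambda>t. expo (g \<otimes> t) - expo t"
  have "[?F (x \<otimes> w [^] j) = ?F x] (mod int (p ^ a))" if "x \<in> carrier G" for x and j :: int
  proof -
    have "[?F (x \<otimes> w [^] j) = (expo (g \<otimes> x) + j) - (expo x + j)] (mod int (p ^ a))"
      using expo_cong[of "g \<otimes> x" j] expo_cong[of x j] that assms
      by (intro cong_diff) (simp_all add: m_assoc)
    then show ?thesis by simp
  qed
  then have "[(\<Sum>t\<in>T. ?F (h \<otimes> t)) = V g] (mod int (p ^ a))"
    unfolding V_def using sum_translate_cong[OF assms(2), of ?F] by blast
  then have "[(\<Sum>t\<in>T. ?F (h \<otimes> t)) + V h = V g + V h] (mod int (p ^ a))"
    by (intro cong_add) auto
  moreover have "V (g \<otimes> h) = (\<Sum>t\<in>T. ?F (h \<otimes> t)) + V h"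
    unfolding V_def sum.distrib[symmetric] using assms T_props
    by (intro sum.cong) (auto simp: m_assoc)
  ultimately show ?thesis by simp
qed

lemma V_one: "[V \<one> = 0] (mod int (p ^ a))"
proof -
  have "V \<one> = 0" unfolding V_def by (intro sum.neutral) (simp add: T_props(1))
  then show ?thesis by simp
qed

lemma V_pow: "g \<in> carrier G \<Longrightarrow> [V (g [^] (i::nat)) = int i * V g] (mod int (p ^ a))"
proof (induction i)
  case 0 then show ?case using V_one by simp
next
  case (Suc i)
  then have "[V (g [^] i \<otimes> g) = int i * V g + V g] (mod int (p ^ a))"
    using V_mult[of "g [^] i" g] by (meson cong_add cong_refl cong_trans nat_pow_closed)
  then show ?case by (simp add: algebra_simps)
qed

end

text \<open>Burnside's transfer condition: for w of finite order it says that the normaliser of <w>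
  equals the centraliser of w.\<close>

definition (in group) fusion_free :: "'a \<Rightarrow> bool" where
  "fusion_free w \<longleftrightarrow> (\<forall>s\<in>carrier G. \<forall>j::int. s \<otimes> w = w [^] j \<otimes> s \<longrightarrow> s \<otimes> w = w \<otimes> s)"

context group
begin

lemma conj_int_pow:
  assumes "s \<in> carrier G" "x \<in> carrier G" "y \<in> carrier G" "s \<otimes> x = y \<otimes> s"
  shows "s \<otimes> x [^] (i::int) = y [^] i \<otimes> s"
proof -
  have nat: "s \<otimes> x [^] n = y [^] n \<otimes> s" for n :: nat
  proof (induction n)
    case (Suc n)
    have "s \<otimes> x [^] Suc n = s \<otimes> x [^] n \<otimes> x" using assms by (simp add: m_assoc)
    also have "\<dots> = y [^] n \<otimes> (s \<otimes> x)" using assms Suc by (simp add: m_assoc)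
    also have "\<dots> = y [^] Suc n \<otimes> s" using assms by (simp add: m_assoc)
    finally show ?case .
  qed (use assms in simp)
  have neg: "s \<otimes> inv (x [^] n) = inv (y [^] n) \<otimes> s" for n :: nat
  proof -
    have "inv (y [^] n) \<otimes> (s \<otimes> x [^] n) \<otimes> inv (x [^] n) = inv (y [^] n) \<otimes> (y [^] n \<otimes> s) \<otimes> inv (x [^] n)"
      using nat by simp
    moreover have "inv (y [^] n) \<otimes> (s \<otimes> x [^] n) \<otimes> inv (x [^] n) = inv (y [^] n) \<otimes> s"
      using assms by (simp add: m_assoc)
    moreover have "inv (y [^] n) \<otimes> (y [^] n \<otimes> s) \<otimes> inv (x [^] n) = s \<otimes> inv (x [^] n)"
      using assms by (simp flip: m_assoc)
    ultimately show ?thesis by simp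
  qed
  show ?thesis
    using nat neg assms by (cases i rule: int_cases2) (simp_all add: int_pow_int int_pow_neg)
qed

lemma centralizer_subgroup:
  assumes "v \<in> carrier G"
  shows "subgroup {x \<in> carrier G. x \<otimes> v = v \<otimes> x} G"
proof (rule subgroupI)
  fix x assume "x \<in> {x \<in> carrier G. x \<otimes> v = v \<otimes> x}"
  then have x: "x \<in> carrier G" "x \<otimes> v = v \<otimes> x" by auto
  then have "v \<otimes> x [^] (-1::int) = x [^] (-1::int) \<otimes> v" using conj_int_pow[of v x x "-1"] assms by simp
  then show "inv x \<in> {x \<in> carrier G. x \<otimes> v = v \<otimes> x}" using x by (simp add: int_pow_neg)
next
  fix x y assume "x \<in> {x \<in> carrier G. x \<otimes> v = v \<otimes> x}" "y \<in> {x \<in> carrier G. x \<otimes> v = v \<otimes> x}"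
  then show "x \<otimes> y \<in> {x \<in> carrier G. x \<otimes> v = v \<otimes> x}" using assms by (auto simp: m_assoc) (simp flip: m_assoc)
qed (use assms in auto)

end

section \<open>Double cosets of a cyclic Sylow subgroup and the transfer of its generator\<close>

context cyclic_sylow
begin

abbreviation C :: "'a set" where "C \<equiv> {x \<in> carrier G. x \<otimes> w = w \<otimes> x}"

definition dcos :: "'a \<Rightarrow> 'a set" where
  "dcos x = {w [^] i \<otimes> x \<otimes> w [^] j | (i::int) (j::int). True}"
definition drep :: "'a \<Rightarrow> 'a" where "drep x = (SOME y. y \<in> dcos x)"
text \<open>The transfer of \<open>w\<close> modulo \<open>p\<close> does not depend on the logarithm. This one is in addition invariant
  under left multiplication by \<open>w\<close> outside \<open>C\<close>, so that only the cosets in \<open>C\<close> contribute.\<close>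

definition dexpo :: "'a \<Rightarrow> int" where
  "dexpo x = (if x \<in> C then expo x else (SOME j. \<exists>i::int. x = w [^] i \<otimes> drep x \<otimes> w [^] j))"

lemma dcos_shift:
  assumes x: "x \<in> carrier G"
  shows "w [^] (i'::int) \<otimes> (w [^] (i::int) \<otimes> x \<otimes> w [^] (j::int)) \<otimes> w [^] (j'::int)
    = w [^] (i' + i) \<otimes> x \<otimes> w [^] (j + j')"
proof -
  have "w [^] i' \<otimes> (w [^] i \<otimes> x \<otimes> w [^] j) \<otimes> w [^] j'
      = (w [^] i' \<otimes> w [^] i) \<otimes> x \<otimes> (w [^] j \<otimes> w [^] j')"
    using x by (simp add: m_assoc)
  then show ?thesis by (simp only: int_pow_mult w)
qed

lemma dcos_eq:
  assumes x: "x \<in> carrier G"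
  shows "dcos (w [^] (i::int) \<otimes> x \<otimes> w [^] (j::int)) = dcos x"
proof
  let ?y = "w [^] i \<otimes> x \<otimes> w [^] j"
  show "dcos ?y \<subseteq> dcos x" unfolding dcos_def using dcos_shift[OF x] by auto
  have "w [^] (a - i) \<otimes> ?y \<otimes> w [^] (b - j) = w [^] a \<otimes> x \<otimes> w [^] b" for a b :: int
    using dcos_shift[OF x, of "a - i" i j "b - j"] by simp
  then show "dcos x \<subseteq> dcos ?y" unfolding dcos_def by clarsimp metis
qed

lemma drep_eq:
  assumes x: "x \<in> carrier G"
  shows "\<exists>(i::int) (j::int). drep x = w [^] i \<otimes> x \<otimes> w [^] j"
proof -
  have "w [^] (0::int) \<otimes> x \<otimes> w [^] (0::int) \<in> dcos x" unfolding dcos_def by blast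
  then have "drep x \<in> dcos x" unfolding drep_def by (rule someI)
  then show ?thesis unfolding dcos_def by auto
qed

lemma drep_closed: "x \<in> carrier G \<Longrightarrow> drep x \<in> carrier G"
  using drep_eq by (metis int_pow_closed m_closed w)

lemma C_shift_aux:
  assumes "x \<in> C" shows "w [^] (i::int) \<otimes> x \<otimes> w [^] (j::int) \<in> C"
proof -
  have "subgroup C G" by (rule centralizer_subgroup) simp
  moreover have "w [^] (i::int) \<in> C" for i using int_pow_mult[of w i 1] int_pow_mult[of w 1 i] by (simp add: add.commute)
  ultimately show ?thesis using assms subgroup.m_closed by metis
qed

lemma C_shift:
  assumes x: "x \<in> carrier G"
  shows "w [^] (i::int) \<otimes> x \<otimes> w [^] (j::int) \<in> C \<longleftrightarrow> x \<in> C"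
proof
  assume "w [^] i \<otimes> x \<otimes> w [^] j \<in> C"
  then have "w [^] (- i) \<otimes> (w [^] i \<otimes> x \<otimes> w [^] j) \<otimes> w [^] (- j) \<in> C" by (rule C_shift_aux)
  then show "x \<in> C" unfolding dcos_shift[OF x] using x by simp
qed (rule C_shift_aux)

text \<open>If p did not divide d, then \<open>w [^] d\<close> would generate <w>, so conjugation by
  r would carry w into <w>, and the absence of fusion would put r into \<open>C\<close>.\<close>

lemma noncentral_pow_conj:
  assumes ff: "fusion_free w" and r: "r \<in> carrier G" "r \<notin> C"
    and eq: "r \<otimes> w [^] (d::int) = w [^] (e::int) \<otimes> r"
  shows "int p dvd d"
proof (rule ccontr)
  assume "\<not> int p dvd d"
  then have "coprime (int p) d" using prime_p by (intro prime_imp_coprime) auto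
  then have "coprime d (int (p ^ a))" by (simp add: coprime_commute)
  then obtain k where k: "[d * k = 1] (mod int (p ^ a))" using cong_solve_coprime_int by blast
  have "r \<otimes> (w [^] d) [^] k = (w [^] e) [^] k \<otimes> r" using conj_int_pow[OF _ _ _ eq] r by simp
  moreover have "(w [^] d) [^] k = w" using k w_pow_eq[of "d * k" 1] by (simp add: int_pow_pow)
  ultimately have "r \<otimes> w = w [^] (e * k) \<otimes> r" by (simp add: int_pow_pow)
  then show False using ff r unfolding fusion_free_def by blast
qed

text \<open>Outside \<open>C\<close> the right exponent in w^i r w^j is determined modulo p: two
  such forms of one element give a relation r w^d = w^e r, where d is the difference of the right
  exponents, and p divides d. The left factor therefore has no influence.\<close>

lemma dexpo_noncentral:
  assumes ff: "fusion_free w" and x: "x \<in> carrier G" "x \<notin> C"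
  shows "[dexpo (w [^] (i0::int) \<otimes> x \<otimes> w [^] j0) = dexpo x + j0] (mod int p)"
proof -
  let ?y = "w [^] i0 \<otimes> x \<otimes> w [^] j0" and ?r = "drep x"
  have ex: "\<exists>i::int. z = w [^] i \<otimes> drep z \<otimes> w [^] dexpo z" if z: "z \<in> carrier G" "z \<notin> C" for z
  proof -
    obtain i j :: int where "drep z = w [^] i \<otimes> z \<otimes> w [^] j" using drep_eq z by blast
    then have "w [^] (- i) \<otimes> drep z \<otimes> w [^] (- j) = z" using dcos_shift[OF z(1), of "- i" i j "- j"] z by simp
    then have "\<exists>j. \<exists>i::int. z = w [^] i \<otimes> drep z \<otimes> w [^] (j::int)" by metis
    then have "\<exists>i::int. z = w [^] i \<otimes> drep z \<otimes> w [^] (SOME j::int. \<exists>i::int. z = w [^] i \<otimes> drep z \<otimes> w [^] j)"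
      by (rule someI_ex)
    then show ?thesis unfolding dexpo_def if_not_P[OF z(2)] .
  qed
  have r: "?r \<in> carrier G" using drep_closed x by simp
  have y: "?y \<in> carrier G" "?y \<notin> C" using x C_shift[OF x(1)] by auto
  have dr: "drep ?y = ?r" unfolding drep_def using dcos_eq[OF x(1)] by simp
  obtain i :: int where i: "x = w [^] i \<otimes> ?r \<otimes> w [^] dexpo x" using ex[OF x] by blast
  obtain i' :: int where i': "?y = w [^] i' \<otimes> ?r \<otimes> w [^] dexpo ?y" using ex[OF y] dr by metis
  have rC: "?r \<notin> C" using C_shift[OF r] i x(2) by metis
  have "?y = w [^] (i0 + i) \<otimes> ?r \<otimes> w [^] (dexpo x + j0)"
    using dcos_shift[OF r, of i0 i "dexpo x" j0] i by simp
  then have "w [^] (- i') \<otimes> ?y \<otimes> w [^] (- (dexpo x + j0)) = w [^] (- i' + (i0 + i)) \<otimes> ?r"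
    using dcos_shift[OF r, of "- i'" "i0 + i" "dexpo x + j0" "- (dexpo x + j0)"] r by simp
  moreover have "w [^] (- i') \<otimes> ?y \<otimes> w [^] (- (dexpo x + j0)) = ?r \<otimes> w [^] (dexpo ?y - (dexpo x + j0))"
    using dcos_shift[OF r, of "- i'" i' "dexpo ?y" "- (dexpo x + j0)"] r i'
    by (simp add: algebra_simps)
  ultimately have "int p dvd dexpo ?y - (dexpo x + j0)"
    using noncentral_pow_conj[OF ff r rC] by metis
  then show ?thesis by (simp add: cong_iff_dvd_diff)
qed

lemma p_dvd_q: "int p dvd int (p ^ a)"
  using a_pos by (simp add: dvd_power)

lemma dexpo_cong:
  assumes ff: "fusion_free w" and x: "x \<in> carrier G"
  shows "[dexpo (x \<otimes> w [^] j) = dexpo x + j] (mod int p)"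
proof (cases "x \<in> C")
  case True
  then have "x \<otimes> w [^] j \<in> C" using C_shift[OF x, of 0 j] x by simp
  then show ?thesis
    using True expo_cong[OF x, of j] p_dvd_q cong_dvd_modulus unfolding dexpo_def by auto
next
  case False
  then show ?thesis using dexpo_noncentral[OF ff x, of 0 j] x by simp
qed

lemma V_w_cong:
  assumes ff: "fusion_free w"
  shows "[V w = int (card (T \<inter> C))] (mod int p)"
proof -
  \<comment> \<open>The difference of the two logarithms is constant on cosets modulo p, so its sum
    over T survives translation by w and \<open>expo\<close> may be replaced by
    \<open>dexpo\<close>. A representative in \<open>C\<close> then contributes 1, since there wt =
    tw, and any other contributes 0.\<close>
  define D where "D = (\<lambda>x. expo x - dexpo x)"
  have "[D (x \<otimes> w [^] j) = D x] (mod int p)" if x: "x \<in> carrier G" for x and j :: int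
  proof -
    have "[expo (x \<otimes> w [^] j) = expo x + j] (mod int p)"
      using expo_cong[OF x] p_dvd_q cong_dvd_modulus by blast
    from cong_diff[OF this dexpo_cong[OF ff x, of j]] show ?thesis by (simp add: D_def)
  qed
  then have "[(\<Sum>t\<in>T. D (w \<otimes> t)) = (\<Sum>t\<in>T. D t)] (mod int p)"
    by (intro sum_translate_cong) auto
  then have 1: "[(\<Sum>t\<in>T. D (w \<otimes> t)) - (\<Sum>t\<in>T. D t) = 0] (mod int p)"
    by (simp add: cong_iff_dvd_diff)
  have "[dexpo (w \<otimes> t) - dexpo t = (if t \<in> C then 1 else 0)] (mod int p)" if t: "t \<in> T" for t
  proof (cases "t \<in> C")
    case True
    then have "[dexpo (w \<otimes> t) = dexpo t + 1] (mod int p)"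
      using dexpo_cong[OF ff, of t 1] by simp
    from cong_diff[OF this cong_refl[of "dexpo t"]] show ?thesis using True by simp
  next
    case False
    have "t \<in> carrier G" using t T_props by simp
    then have "[dexpo (w \<otimes> t) = dexpo t] (mod int p)"
      using dexpo_noncentral[OF ff _ False, of 1 0] by simp
    from cong_diff[OF this cong_refl[of "dexpo t"]] show ?thesis using False by (simp only: if_False) simp
  qed
  then have "[(\<Sum>t\<in>T. dexpo (w \<otimes> t) - dexpo t) = (\<Sum>t\<in>T. if t \<in> C then 1 else 0)] (mod int p)"
    by (rule cong_sum)
  also have "(\<Sum>t\<in>T. if t \<in> C then 1 else 0) = int (card (T \<inter> C))"
    by (subst sum.inter_restrict[OF finite_T, symmetric]) simp
  finally have "[((\<Sum>t\<in>T. D (w \<otimes> t)) - (\<Sum>t\<in>T. D t)) + (\<Sum>t\<in>T. dexpo (w \<otimes> t) - dexpo t)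
      = 0 + int (card (T \<inter> C))] (mod int p)"
    using 1 by (intro cong_add)
  moreover have "V w = ((\<Sum>t\<in>T. D (w \<otimes> t)) - (\<Sum>t\<in>T. D t)) + (\<Sum>t\<in>T. dexpo (w \<otimes> t) - dexpo t)"
    unfolding V_def D_def by (simp add: sum_subtractf)
  ultimately show ?thesis by simp
qed

text \<open>The number of cosets inside \<open>C\<close> is |C|/p^a, a divisor of l and hence prime
  to p. Thus the transfer maps <w> onto the integers modulo p^a.\<close>

lemma V_w_coprime:
  assumes ff: "fusion_free w"
  shows "coprime (V w) (int (p ^ a))"
proof -
  have sub: "subgroup C G" by (rule centralizer_subgroup) simp
  have card_C: "card C = p ^ a * card (T \<inter> C)"
  proof (rule card_coset_closed)
    fix x and i :: int assume "x \<in> C"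
    then show "x \<otimes> w [^] i \<in> C" using C_shift[of x 0 i] by simp
  qed auto
  have "card C dvd p ^ a * l"
    unfolding lagrange[OF sub, unfolded order_G, symmetric] by (rule dvd_triv_right)
  then have "card (T \<inter> C) dvd l"
    unfolding card_C using q_pos dvd_times_left_cancel_iff[of "p ^ a"] by blast
  then have "\<not> p dvd card (T \<inter> C)" using ndvd dvd_trans by blast
  then have "\<not> int p dvd V w" using cong_dvd_iff[OF V_w_cong[OF ff]] by simp
  then have "coprime (int p) (V w)" using prime_p by (intro prime_imp_coprime) auto
  then show ?thesis by (simp add: coprime_commute)
qed

text \<open>The complement is the kernel of the transfer, which is bijective on <w>. Writing it as
  the solution set of y^l = 1 frees it from w and from the chosen representatives and makes it
  visibly invariant under conjugation.\<close>

theorem normal_p_complement: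
  assumes ff: "fusion_free w"
  shows "subgroup {y \<in> carrier G. y [^] l = \<one>} G" "card {y \<in> carrier G. y [^] l = \<one>} = l"
proof -
  let ?q = "int (p ^ a)"
  define K where "K = {g \<in> carrier G. [V g = 0] (mod ?q)}"
  have K: "subgroup K G"
  proof (rule subgroupI)
    show "K \<subseteq> carrier G" "K \<noteq> {}" using V_one by (auto simp: K_def)
    fix x assume x: "x \<in> K"
    then have xc: "x \<in> carrier G" "[V x = 0] (mod ?q)" by (auto simp: K_def)
    have "[V x + V (inv x) = 0] (mod ?q)"
      using V_mult[of x "inv x"] V_one xc(1) by (simp del: of_nat_power) (metis cong_sym cong_trans)
    then have "[V (inv x) = 0] (mod ?q)"
      using xc(2) unfolding cong_0_iff by (simp add: dvd_add_right_iff)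
    then show "inv x \<in> K" using xc(1) by (simp add: K_def)
    fix y assume "y \<in> K"
    then have y: "y \<in> carrier G" "[V y = 0] (mod ?q)" by (auto simp: K_def)
    have "[V x + V y = 0 + 0] (mod ?q)" using xc y by (intro cong_add)
    then have "[V (x \<otimes> y) = 0] (mod ?q)" using V_mult[OF xc(1) y(1)] cong_trans by (metis add_0)
    then show "x \<otimes> y \<in> K" using xc y by (simp add: K_def)
  qed
  obtain k where k: "[V w * k = 1] (mod ?q)" using cong_solve_coprime_int V_w_coprime[OF ff] by blast
  have cop: "coprime l (p ^ a)" using prime_p ndvd by (metis coprime_commute coprime_power_left_iff prime_imp_coprime)
  let ?f = "\<lambda>(g, i). g \<otimes> w [^] (i::nat)"
  have "bij_betw ?f (K \<times> {..<p ^ a}) (carrier G)"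
    unfolding bij_betw_def
  proof
    have V_shift: "[V (g \<otimes> w [^] i) = V g + int i * V w] (mod ?q)" if "g \<in> carrier G" for g i
      using V_mult[OF that, of "w [^] i"] cong_add[OF cong_refl V_pow[OF w, of i], of "V g"]
      by (meson cong_trans nat_pow_closed w)
    show "inj_on ?f (K \<times> {..<p ^ a})"
    proof (rule inj_onI, clarify)
      fix g g' and i j :: nat
      assume a: "g \<in> K" "g' \<in> K" "i < p ^ a" "j < p ^ a" "g \<otimes> w [^] i = g' \<otimes> w [^] j"
      have g: "g \<in> carrier G" "g' \<in> carrier G" "[V g = 0] (mod ?q)" "[V g' = 0] (mod ?q)"
        using a by (auto simp: K_def)
      have "[int i * V w = V (g \<otimes> w [^] i)] (mod ?q)"
        using V_shift[OF g(1), of i] cong_add[OF g(3) cong_refl[of "int i * V w"]] cong_sym cong_trans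
        by (metis add_0)
      moreover have "[V (g' \<otimes> w [^] j) = int j * V w] (mod ?q)"
        using V_shift[OF g(2), of j] cong_add[OF g(4) cong_refl[of "int j * V w"]] cong_trans
        by (metis add_0)
      ultimately have "[int i * V w = int j * V w] (mod ?q)" using a(5) cong_trans by metis
      then have "[int i = int j] (mod ?q)" using V_w_coprime[OF ff] cong_mult_rcancel by blast
      then have "i = j" using a(3,4) cong_int_iff cong_less_modulus_unique_nat by blast
      then show "g = g' \<and> i = j" using a(5) g by simp
    qed
    show "?f ` (K \<times> {..<p ^ a}) = carrier G"
    proof
      show "?f ` (K \<times> {..<p ^ a}) \<subseteq> carrier G" by (auto simp: K_def)
      show "carrier G \<subseteq> ?f ` (K \<times> {..<p ^ a})"
      proof
        fix x assume x: "x \<in> carrier G"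
        \<comment> \<open>As k inverts \<open>V w\<close>, this i solves
          \<open>int i * V w = V x\<close> modulo p^a; dividing x by \<open>w [^] i\<close> then
          lands in the kernel.\<close>
        define i where "i = nat (k * V x mod ?q)"
        have i: "int i = k * V x mod ?q" "i < p ^ a"
          using q_pos unfolding i_def by (simp_all add: nat_less_iff)
        let ?g = "x \<otimes> inv (w [^] i)"
        have g: "?g \<in> carrier G" "?g \<otimes> w [^] i = x" using x by (simp_all add: m_assoc)
        have "[int i * V w = k * V x * V w] (mod ?q)"
          unfolding i(1) by (intro cong_mult cong_refl) (simp add: cong_def)
        also have "k * V x * V w = V w * k * V x" by simp
        also have "[V w * k * V x = 1 * V x] (mod ?q)" using k by (intro cong_mult cong_refl)
        finally have "[int i * V w = V x] (mod ?q)" by simp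
        moreover have "[V x = V ?g + int i * V w] (mod ?q)" using V_shift[OF g(1), of i] g(2) by simp
        ultimately have "[V x = V ?g + V x] (mod ?q)"
          using cong_add[OF cong_refl] cong_trans by blast
        then have "[V ?g = 0] (mod ?q)" by (simp add: cong_iff_dvd_diff)
        then have "?g \<in> K" using g by (simp add: K_def)
        then show "x \<in> ?f ` (K \<times> {..<p ^ a})" using i(2) g(2) by force
      qed
    qed
  qed
  then have "card (carrier G) = card K * p ^ a"
    by (metis bij_betw_same_card card_cartesian_product card_lessThan)
  then have cK: "card K = l" using order_G q_pos unfolding order_def
    by (metis less_irrefl mult.commute mult_left_cancel)
  have "K = {y \<in> carrier G. y [^] l = \<one>}"
  proof
    show "K \<subseteq> {y \<in> carrier G. y [^] l = \<one>}"
      using pow_card_subgroup[OF K] cK by (auto simp: K_def)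
    show "{y \<in> carrier G. y [^] l = \<one>} \<subseteq> K"
    proof clarify
      fix y assume y: "y \<in> carrier G" "y [^] l = \<one>"
      then have "[int l * V y = 0] (mod ?q)" using V_pow[of y l] V_one cong_sym cong_trans by metis
      then have "?q dvd int l * V y" by (simp add: cong_0_iff)
      moreover have "coprime ?q (int l)" using cop by (simp add: coprime_commute)
      ultimately have "?q dvd V y" by (simp add: coprime_dvd_mult_right_iff)
      then show "y \<in> K" using y by (simp add: K_def cong_0_iff)
    qed
  qed
  then show "subgroup {y \<in> carrier G. y [^] l = \<one>} G" "card {y \<in> carrier G. y [^] l = \<one>} = l"
    using K cK by auto
qed

end

section \<open>Counting conjugates\<close>

lemma pi_part_insert_ndvd:
  assumes "Factorial_Ring.prime p" "\<not> p dvd n"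
  shows "pi_part (insert p \<pi>) n = pi_part \<pi> n"
    and "pi_part (pi_compl (insert p \<pi>)) n = pi_part (pi_compl \<pi>) n"
proof -
  have "d dvd n \<and> pi_number (insert p \<pi>) d \<longleftrightarrow> d dvd n \<and> pi_number \<pi> d"
    "d dvd n \<and> pi_number (pi_compl (insert p \<pi>)) d \<longleftrightarrow> d dvd n \<and> pi_number (pi_compl \<pi>) d" for d
    using assms dvd_trans unfolding pi_number_def pi_compl_def by auto
  then show "pi_part (insert p \<pi>) n = pi_part \<pi> n"
    "pi_part (pi_compl (insert p \<pi>)) n = pi_part (pi_compl \<pi>) n"
    unfolding pi_part_def by simp_all
qed

lemma pi_part_prime_power_mult:
  assumes p: "Factorial_Ring.prime p" and l: "\<not> p dvd l" "l > 0" and "p \<notin> \<pi>"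
  shows "pi_part \<pi> (p ^ a * l) = pi_part \<pi> l"
    and "pi_part (pi_compl \<pi>) (p ^ a * l) = p ^ a * pi_part (pi_compl \<pi>) l"
    and "pi_part (insert p \<pi>) (p ^ a * l) = p ^ a * pi_part \<pi> l"
    and "pi_part (pi_compl (insert p \<pi>)) (p ^ a * l) = pi_part (pi_compl \<pi>) l"
proof -
  have q: "p ^ a > 0" using p by (simp add: prime_gt_0_nat)
  have num: "pi_number (pi_compl \<pi>) (p ^ a)" "pi_number (insert p \<pi>) (p ^ a)"
    using pi_number_singleton_prime_power[OF p, of a] assms
    unfolding pi_number_def pi_compl_def by auto
  have "pi_number (pi_compl (pi_compl (insert p \<pi>))) (p ^ a)" using num pi_compl_compl by blast
  then show "pi_part \<pi> (p ^ a * l) = pi_part \<pi> l"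
      "pi_part (pi_compl \<pi>) (p ^ a * l) = p ^ a * pi_part (pi_compl \<pi>) l"
      "pi_part (insert p \<pi>) (p ^ a * l) = p ^ a * pi_part \<pi> l"
      "pi_part (pi_compl (insert p \<pi>)) (p ^ a * l) = pi_part (pi_compl \<pi>) l"
    using pi_part_mult[OF q l(2)] pi_part_insert_ndvd[OF p l(1), of \<pi>] num pi_part_id pi_part_trivial
    by auto
qed

lemma cyclic_psi_pos: "n > 0 \<Longrightarrow> cyclic_psi \<pi> n > 0"
  unfolding cyclic_psi_def using pi_part_pos cyclic_order_sum_pos by simp

lemma cyclic_psi_prime_power_mult:
  assumes p: "Factorial_Ring.prime p" and l: "\<not> p dvd l" "l > 0" and "p \<notin> \<pi>"
  shows "cyclic_psi \<pi> (p ^ a * l) = p ^ a * cyclic_psi \<pi> l"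
    and "cyclic_psi (insert p \<pi>) (p ^ a * l) = cyclic_order_sum (p ^ a) * cyclic_psi \<pi> l"
proof -
  have "\<not> p dvd pi_part \<pi> l" using l pi_part_dvd dvd_trans by blast
  then have "cyclic_order_sum (p ^ a * pi_part \<pi> l) = cyclic_order_sum (p ^ a) * cyclic_order_sum (pi_part \<pi> l)"
    using cyclic_order_sum_prime_power_mult p pi_part_pos l by blast
  then show "cyclic_psi \<pi> (p ^ a * l) = p ^ a * cyclic_psi \<pi> l"
    "cyclic_psi (insert p \<pi>) (p ^ a * l) = cyclic_order_sum (p ^ a) * cyclic_psi \<pi> l"
    unfolding cyclic_psi_def pi_part_prime_power_mult[OF assms] by simp_all
qed

text \<open>This compares the complement in a centraliser, of order l, with the p'-part l*s of the
  group order. A nontrivial \<pi>-part of s makes the estimate strict, so equality means that the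
  complement carries the full \<pi>-part.\<close>

lemma cyclic_psi_mult_le:
  assumes "l > 0" "s > 0"
  shows "s * cyclic_psi \<pi> l \<le> cyclic_psi \<pi> (l * s)"
    and "s * cyclic_psi \<pi> l = cyclic_psi \<pi> (l * s) \<Longrightarrow> pi_part \<pi> l = pi_part \<pi> (l * s)"
proof -
  let ?k = "pi_part (pi_compl \<pi>) l" and ?m = "pi_part \<pi> l"
  let ?t = "pi_part (pi_compl \<pi>) s" and ?r = "pi_part \<pi> s"
  have s: "s = ?t * ?r" using pi_part_mult_compl[OF assms(2), of \<pi>] by (simp add: mult.commute)
  have pos: "?k > 0" "?m > 0" "?t > 0" "?r > 0" using assms pi_part_pos by auto
  have L: "s * cyclic_psi \<pi> l = (?k * ?t) * (?r * cyclic_order_sum ?m)"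
    unfolding cyclic_psi_def by (subst s) (simp only: ac_simps)
  have R: "cyclic_psi \<pi> (l * s) = (?k * ?t) * cyclic_order_sum (?m * ?r)"
    unfolding cyclic_psi_def pi_part_mult[OF assms] by simp
  show "s * cyclic_psi \<pi> l \<le> cyclic_psi \<pi> (l * s)"
    unfolding L R using cyclic_order_sum_mult_le(1) pos by simp
  assume "s * cyclic_psi \<pi> l = cyclic_psi \<pi> (l * s)"
  then have "?r * cyclic_order_sum ?m = cyclic_order_sum (?m * ?r)" unfolding L R using pos by simp
  then have "?r = 1" using cyclic_order_sum_mult_le(2)[OF pos(2,4)] pos(4) by linarith
  then show "pi_part \<pi> l = pi_part \<pi> (l * s)" using pi_part_mult[OF assms, of \<pi>] by simp
qed

text \<open>The equality condition in intrinsic form. As a solution set of x^k = 1 the Hall subgroup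
  is automatically normal and can be carried from a normal p-complement to the whole group by
  comparing equations; the cyclic complement is represented by a generator.\<close>

definition (in group) hall_split :: "nat set \<Rightarrow> bool" where
  "hall_split \<pi> \<longleftrightarrow>
     (let k = pi_part (pi_compl \<pi>) (order G); H = {x \<in> carrier G. x [^] k = \<one>}
      in subgroup H G \<and> card H = k \<and> (\<exists>c\<in>carrier G. ord c = pi_part \<pi> (order G)))"

context group
begin

abbreviation centralizer :: "'a \<Rightarrow> 'a set" where
  "centralizer v \<equiv> {x \<in> carrier G. x \<otimes> v = v \<otimes> x}"

lemma ord_conj_eq:
  assumes "g \<in> carrier G" "u \<in> carrier G" "v \<in> carrier G" "g \<otimes> u = v \<otimes> g"
  shows "ord u = ord v"
proof -
  have "u [^] n = \<one> \<longleftrightarrow> v [^] n = \<one>" for n :: nat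
    using conj_int_pow[OF assms(1,2,3,4), of "int n"] assms
    by (metis int_pow_int l_cancel_one' nat_pow_closed r_cancel_one')
  then show ?thesis using ord_unique[OF assms(2), of "ord v"] pow_eq_id[OF assms(3)] by blast
qed

text \<open>Double counting of pairs (u, g), each of which determines the conjugate v = g u g^-1.
  This sums over conjugacy classes without class representatives; t is a lower bound for the number
  of conjugates that each v has in Y.\<close>

lemma sum_centralizer_le:
  fixes f :: "'a \<Rightarrow> nat"
  assumes fin: "finite (carrier G)" and Y: "Y \<subseteq> carrier G" and B: "B \<subseteq> carrier G"
    and count: "\<And>v. v \<in> B \<Longrightarrow> t * card (centralizer v) \<le> card {(u, g) \<in> Y \<times> carrier G. g \<otimes> u = v \<otimes> g}"
    and f: "\<And>g u v. \<lbrakk>g \<in> carrier G; u \<in> Y; v \<in> B; g \<otimes> u = v \<otimes> g\<rbrakk> \<Longrightarrow> f u = f v"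
  shows "t * (\<Sum>v\<in>B. f v * card (centralizer v)) \<le> order G * (\<Sum>u\<in>Y. f u)"
proof -
  have finYB: "finite Y" "finite B" using Y B fin finite_subset by auto
  let ?P = "Y \<times> carrier G"
  have "t * (\<Sum>v\<in>B. f v * card (centralizer v)) = (\<Sum>v\<in>B. f v * (t * card (centralizer v)))"
    by (simp add: sum_distrib_left mult.left_commute)
  also have "\<dots> \<le> (\<Sum>v\<in>B. f v * card {(u, g) \<in> ?P. g \<otimes> u = v \<otimes> g})"
    by (intro sum_mono mult_left_mono count) auto
  also have "\<dots> = (\<Sum>v\<in>B. \<Sum>(u, g)\<in>?P. if g \<otimes> u = v \<otimes> g then f v else 0)"
  proof (rule sum.cong[OF refl])
    fix v
    have "(\<Sum>(u, g)\<in>?P. if g \<otimes> u = v \<otimes> g then f v else 0)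
       = (\<Sum>z\<in>{z \<in> ?P. case z of (u, g) \<Rightarrow> g \<otimes> u = v \<otimes> g}. f v)"
      using fin finYB by (subst sum.inter_filter) (auto intro!: sum.cong)
    also have "\<dots> = f v * card {(u, g) \<in> ?P. g \<otimes> u = v \<otimes> g}"
      by (simp add: case_prod_unfold mem_Times_iff conj_assoc)
    finally show "f v * card {(u, g) \<in> ?P. g \<otimes> u = v \<otimes> g}
      = (\<Sum>(u, g)\<in>?P. if g \<otimes> u = v \<otimes> g then f v else 0)" by simp
  qed
  also have "\<dots> = (\<Sum>(u, g)\<in>?P. \<Sum>v\<in>B. if g \<otimes> u = v \<otimes> g then f v else 0)"
    by (subst sum.swap) (simp add: case_prod_unfold)
  also have "\<dots> \<le> (\<Sum>(u, g)\<in>?P. f u)"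
  proof (rule sum_mono, clarify)
    fix u g assume u: "u \<in> Y" and g: "g \<in> carrier G"
    let ?v = "g \<otimes> u \<otimes> inv g"
    have "g \<otimes> u = v \<otimes> g \<Longrightarrow> v = ?v" if "v \<in> B" for v
      using that u g Y B by (simp add: m_assoc subset_iff)
    then have "(\<Sum>v\<in>B. if g \<otimes> u = v \<otimes> g then f v else 0) \<le> (\<Sum>v\<in>B. if v = ?v then f u else 0)"
      using f u g by (intro sum_mono) auto
    also have "\<dots> \<le> f u" using finYB by (simp add: sum.delta)
    finally show "(\<Sum>v\<in>B. if g \<otimes> u = v \<otimes> g then f v else 0) \<le> f u" .
  qed
  also have "\<dots> = order G * (\<Sum>u\<in>Y. f u)"
    by (simp add: order_def sum_distrib_left flip: sum.cartesian_product)
  finally show ?thesis .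
qed

text \<open>The elements carrying a given u to v form a coset of the centraliser of v.\<close>

lemma card_conjugators_ge:
  assumes fin: "finite (carrier G)" and Y: "Y \<subseteq> carrier G" and v: "v \<in> carrier G"
    and R: "R \<subseteq> Y" and conj: "\<And>u. u \<in> R \<Longrightarrow> \<exists>g\<in>carrier G. g \<otimes> u = v \<otimes> g"
  shows "card R * card (centralizer v) \<le> card {(u, g) \<in> Y \<times> carrier G. g \<otimes> u = v \<otimes> g}"
proof -
  obtain \<gamma> where \<gamma>: "\<And>u. u \<in> R \<Longrightarrow> \<gamma> u \<in> carrier G \<and> \<gamma> u \<otimes> u = v \<otimes> \<gamma> u" using conj by metis
  let ?f = "\<lambda>(u, c). (u, c \<otimes> \<gamma> u)"
  have "inj_on ?f (R \<times> centralizer v)" using \<gamma> by (intro inj_onI) auto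
  moreover have "?f ` (R \<times> centralizer v) \<subseteq> {(u, g) \<in> Y \<times> carrier G. g \<otimes> u = v \<otimes> g}"
  proof clarsimp
    fix u c assume u: "u \<in> R" and c: "c \<in> carrier G" "c \<otimes> v = v \<otimes> c"
    have uc: "u \<in> carrier G" using u R Y by auto
    have "c \<otimes> \<gamma> u \<otimes> u = c \<otimes> (v \<otimes> \<gamma> u)" using \<gamma>[OF u] c(1) uc by (simp add: m_assoc)
    also have "\<dots> = (c \<otimes> v) \<otimes> \<gamma> u" using \<gamma>[OF u] c(1) v by (simp add: m_assoc)
    also have "\<dots> = v \<otimes> (c \<otimes> \<gamma> u)" unfolding c(2) using \<gamma>[OF u] c(1) v by (simp add: m_assoc)
    finally show "u \<in> Y \<and> c \<otimes> \<gamma> u \<in> carrier G \<and> c \<otimes> \<gamma> u \<otimes> u = v \<otimes> (c \<otimes> \<gamma> u)"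
      using \<gamma>[OF u] c u R by auto
  qed
  moreover have "finite {(u, g) \<in> Y \<times> carrier G. g \<otimes> u = v \<otimes> g}"
  proof (rule finite_subset)
    show "finite (Y \<times> carrier G)" using fin finite_subset[OF Y fin] by (rule finite_cartesian_product[rotated])
  qed blast
  ultimately have "card (R \<times> centralizer v) \<le> card {(u, g) \<in> Y \<times> carrier G. g \<otimes> u = v \<otimes> g}"
    by (rule card_inj_on_le)
  then show ?thesis by (simp only: card_cartesian_product)
qed

end

section \<open>The induction step\<close>

text \<open>One induction step, in which p is removed from \<open>insert p \<pi>\<close>. Raising to
  the exponent e gives the p-part of an element; the induction hypothesis is needed for the
  subgroups of G, including G itself.\<close>

locale psi_step = group G for G (structure) +
  fixes p a n' :: nat and \<pi> :: "nat set" and e :: nat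
  assumes fin: "finite (carrier G)" and p: "Factorial_Ring.prime p" and a_pos: "a > 0"
    and order_G: "order G = p ^ a * n'" and ndvd: "\<not> p dvd n'" and p_notin: "p \<notin> \<pi>"
    and e: "[e = 1] (mod p ^ a)" "n' dvd e"
    and IH: "\<And>K. subgroup K G \<Longrightarrow> psi \<pi> (G\<lparr>carrier := K\<rparr>) \<le> cyclic_psi \<pi> (card K)"
    and IH_eq: "\<And>K. subgroup K G \<Longrightarrow> psi \<pi> (G\<lparr>carrier := K\<rparr>) = cyclic_psi \<pi> (card K) \<Longrightarrow>
      group.hall_split (G\<lparr>carrier := K\<rparr>) \<pi>"
begin

definition p_fibre_sum :: "'a \<Rightarrow> nat" where
  "p_fibre_sum v = (\<Sum>x\<in>{x \<in> carrier G. x [^] e = v}. pi_part \<pi> (ord x))"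

abbreviation p_elements :: "'a set" where
  "p_elements \<equiv> {v \<in> carrier G. v [^] (p ^ a) = \<one>}"

lemma q_pos: "p ^ a > 0" using p by (simp add: prime_gt_0_nat)

lemma n'_pos: "n' > 0" using ndvd by (metis dvd_0_right gr0I)

lemma coprime_q: "\<not> p dvd m \<Longrightarrow> coprime (p ^ a) m"
  using p by (simp add: prime_imp_coprime)

lemma p_elements_ord: "v \<in> p_elements \<Longrightarrow> ord v dvd p ^ a" using pow_eq_id by auto

lemma pi_part_p_mult:
  assumes "d dvd p ^ a" "m > 0" shows "pi_part \<pi> (d * m) = pi_part \<pi> m"
proof -
  have d: "d > 0" using assms q_pos by (metis dvd_pos_nat)
  have "pi_number (pi_compl \<pi>) (p ^ a)"
    using pi_number_singleton_prime_power[OF p, of a] p_notin unfolding pi_number_def pi_compl_def by auto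
  then show ?thesis using assms pi_part_mult[OF d] pi_part_trivial pi_number_dvd by simp
qed

lemma ord_pow_e: "x \<in> carrier G \<Longrightarrow> ord (x [^] e) = pi_part {p} (ord x)"
proof (rule ord_pow_pi_part[OF fin])
  show "[e = 1] (mod pi_part {p} (order G))"
    unfolding order_G pi_part_singleton[OF p ndvd] by (rule e)
  have "pi_part (pi_compl {p}) (order G) dvd n'"
    unfolding order_G pi_part_prime_power_mult(4)[OF p ndvd n'_pos, of "{}" a, simplified]
    by (rule pi_part_dvd[OF n'_pos])
  then show "pi_part (pi_compl {p}) (order G) dvd e" using e(2) by (rule dvd_trans)
qed

lemma pow_e_p_elements: "x \<in> carrier G \<Longrightarrow> x [^] e \<in> p_elements"
proof -
  assume x: "x \<in> carrier G"
  have "p ^ a * n' dvd e * p ^ a" using e(2) by (metis mult.commute mult_dvd_mono dvd_refl)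
  then have "ord x dvd e * p ^ a" using ord_dvd_group_order[OF x] order_G dvd_trans by metis
  then have "x [^] (e * p ^ a) = \<one>" using x pow_eq_id by blast
  then show ?thesis using x by (simp add: nat_pow_pow)
qed

lemma psi_insert_eq: "psi (insert p \<pi>) G = (\<Sum>v\<in>p_elements. ord v * p_fibre_sum v)"
proof -
  have "psi (insert p \<pi>) G = (\<Sum>x\<in>carrier G. ord (x [^] e) * pi_part \<pi> (ord x))"
    unfolding psi_eq_sum[OF fin]
  proof (rule sum.cong[OF refl])
    fix x assume x: "x \<in> carrier G"
    have "ord x > 0" using ord_ge_1[OF fin x] by simp
    then show "pi_part (insert p \<pi>) (ord x) = ord (x [^] e) * pi_part \<pi> (ord x)"
      using pi_part_insert[OF p p_notin] ord_pow_e[OF x] by simp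
  qed
  also have "\<dots> = (\<Sum>v\<in>p_elements. \<Sum>x\<in>{x \<in> carrier G. x [^] e = v}. ord (x [^] e) * pi_part \<pi> (ord x))"
    using fin pow_e_p_elements by (intro sum.group[symmetric]) auto
  also have "\<dots> = (\<Sum>v\<in>p_elements. ord v * p_fibre_sum v)"
    unfolding p_fibre_sum_def sum_distrib_left by (intro sum.cong) auto
  finally show ?thesis .
qed

lemma psi_eq: "psi \<pi> G = (\<Sum>v\<in>p_elements. p_fibre_sum v)"
proof -
  have "(\<Sum>v\<in>p_elements. \<Sum>x\<in>{x \<in> carrier G. x [^] e = v}. pi_part \<pi> (ord x))
      = (\<Sum>x\<in>carrier G. pi_part \<pi> (ord x))"
    using fin pow_e_p_elements by (intro sum.group) auto
  then show ?thesis unfolding psi_eq_sum[OF fin] p_fibre_sum_def by simp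
qed

text \<open>Since u commutes with its power v, the centraliser of v contains an element of full
  order p^a, so its Sylow p-subgroup is again cyclic and the transfer applies inside it. The factor
  v has p-power order and leaves the \<pi>-part of the order of y unchanged.\<close>

lemma fibre:
  assumes v: "v \<in> carrier G" and u: "u \<in> carrier G" "ord u = p ^ a" "v = u [^] (j::int)"
    and ff: "group.fusion_free (G\<lparr>carrier := centralizer v\<rparr>) u"
  obtains l where "card (centralizer v) = p ^ a * l" "\<not> p dvd l"
    "subgroup {y \<in> centralizer v. y [^] l = \<one>} G" "card {y \<in> centralizer v. y [^] l = \<one>} = l"
    "p_fibre_sum v = psi \<pi> (G\<lparr>carrier := {y \<in> centralizer v. y [^] l = \<one>}\<rparr>)"
proof -
  let ?D = "centralizer v"
  let ?G = "G\<lparr>carrier := ?D\<rparr>"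
  have D: "subgroup ?D G" by (rule centralizer_subgroup[OF v])
  have finD: "finite ?D" using fin by simp
  interpret D: group ?G using subgroup_imp_group[OF D] .
  have uD: "u \<in> ?D" using conj_int_pow[of u u u j] u by simp
  have "ord u = D.ord u" using ord_subgroup[OF is_group D] by simp
  then have "p ^ a dvd card ?D" using D.ord_dvd_group_order[of u] uD u(2) by (simp add: order_def)
  then obtain l where l: "card ?D = p ^ a * l" by blast
  have "card ?D dvd p ^ a * n'"
    unfolding lagrange[OF D, unfolded order_G, symmetric] by (rule dvd_triv_right)
  then have ln': "l dvd n'" unfolding l using q_pos dvd_times_left_cancel_iff[of "p ^ a"] by blast
  then have pl: "\<not> p dvd l" using ndvd dvd_trans by blast
  interpret S: cyclic_sylow ?G u p a l
  proof (intro cyclic_sylow.intro cyclic_sylow_axioms.intro)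
    show "finite (carrier ?G)" "u \<in> carrier ?G" "order ?G = p ^ a * l"
      using finD uD l by (simp_all add: order_def)
    show "D.ord u = p ^ a" using \<open>ord u = D.ord u\<close> u(2) by simp
  qed (fact D.is_group p pl a_pos)+
  define K where "K = {y \<in> ?D. y [^] l = \<one>}"
  have "{y \<in> carrier ?G. y [^]\<^bsub>?G\<^esub> l = \<one>\<^bsub>?G\<^esub>} = K"
    unfolding K_def using nat_pow_consistent by simp
  then have K: "subgroup K ?G" "card K = l" using S.normal_p_complement[OF ff] by auto
  then have KG: "subgroup K G" using incl_subgroup[OF D] by blast
  have vu: "v [^] (p ^ a) = \<one>"
  proof -
    have "(u [^] j) [^] int (p ^ a) = \<one>" using u(1,2) by (simp add: int_pow_pow int_pow_eq_id del: of_nat_power)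
    then show ?thesis using u(3) by (simp only: int_pow_int)
  qed
  then have ordv: "ord v dvd p ^ a" using v pow_eq_id by blast
  have part: "pi_part \<pi> (ord (v \<otimes> y)) = pi_part \<pi> (ord y)" and yfib: "(v \<otimes> y) [^] e = v"
    if y: "y \<in> K" for y
  proof -
    have yc: "y \<in> carrier G" "v \<otimes> y = y \<otimes> v" "y [^] l = \<one>" using y unfolding K_def by auto
    then have yl: "ord y dvd l" using pow_eq_id by blast
    have "coprime (ord v) (ord y)" using coprime_q[OF pl] ordv yl by (meson coprime_divisors)
    then have "ord (v \<otimes> y) = ord v * ord y" using ord_mult_coprime v yc by blast
    then show "pi_part \<pi> (ord (v \<otimes> y)) = pi_part \<pi> (ord y)"
      using pi_part_p_mult[OF ordv] ord_ge_1[OF fin yc(1)] by simp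
    have "ord y dvd e" using yl ln' e(2) dvd_trans by metis
    then have "y [^] e = \<one>" using yc pow_eq_id by blast
    moreover have "v [^] e = v"
    proof -
      have "[int e = int 1] (mod int (ord v))" using e(1) ordv cong_dvd_modulus_nat cong_int_iff by blast
      then have "v [^] int e = v [^] int 1" using v int_pow_eq by (metis cong_iff_dvd_diff cong_sym)
      then show ?thesis using v by (simp add: int_pow_int del: of_nat_1)
    qed
    ultimately show "(v \<otimes> y) [^] e = v" using pow_mult_distrib[OF yc(2) v yc(1)] v by simp
  qed
  have "bij_betw (\<lambda>y. v \<otimes> y) K {x \<in> carrier G. x [^] e = v}"
    unfolding bij_betw_def
  proof
    show "inj_on (\<lambda>y. v \<otimes> y) K" using v by (intro inj_onI) (simp add: K_def)
    show "(\<lambda>y. v \<otimes> y) ` K = {x \<in> carrier G. x [^] e = v}"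
    proof
      show "(\<lambda>y. v \<otimes> y) ` K \<subseteq> {x \<in> carrier G. x [^] e = v}" using yfib v by (auto simp: K_def)
      show "{x \<in> carrier G. x [^] e = v} \<subseteq> (\<lambda>y. v \<otimes> y) ` K"
      proof clarify
        fix x assume x: "x \<in> carrier G" "v = x [^] e"
        let ?y = "inv v \<otimes> x"
        have xv: "x \<otimes> v = v \<otimes> x" using x nat_pow_comm[of x 1 e] by simp
        then have xD: "x \<in> ?D" using x by simp
        have vD: "v \<in> ?D" using v by simp
        have yD: "?y \<in> ?D" using subgroup.m_closed[OF D] subgroup.m_inv_closed[OF D] xD vD by blast
        have "inv v \<otimes> x = x \<otimes> inv v"
          using xv conj_int_pow[of x v v "-1"] x(1) v by (simp add: int_pow_neg)
        \<comment> \<open>\<open>?y\<close> is the p'-part of x: with v = x^e its n'-th power is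
          x^(n' - e n'), which is trivial because e is 1 modulo p^a.\<close>
        then have "?y [^] n' = (inv v) [^] n' \<otimes> x [^] n'" using pow_mult_distrib x(1) v by simp
        also have "(inv v) [^] n' = inv (x [^] (e * n'))"
          unfolding x(2) using x(1) by (simp add: nat_pow_inv nat_pow_pow)
        also have "x [^] (e * n') = x [^] n'"
        proof -
          have "[n' * e = n' * 1] (mod n' * p ^ a)" using e(1) by (metis cong_cmult_leftI mult.commute)
          then have "[e * n' = n'] (mod ord x)"
            using ord_dvd_group_order[OF x(1)] order_G by (metis cong_dvd_modulus_nat mult.commute mult_1)
          then have "[int (e * n') = int n'] (mod int (ord x))" using cong_int_iff by blast
          then have "x [^] int (e * n') = x [^] int n'"
            using x(1) int_pow_eq by (metis cong_iff_dvd_diff cong_sym)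
          then show ?thesis by (simp only: int_pow_int)
        qed
        finally have y1: "?y [^] n' = \<one>" using x(1) by simp
        have yc: "?y \<in> carrier G" using yD by simp
        have "ord ?y dvd p ^ a * l"
          using D.ord_dvd_group_order[of ?y] yD ord_subgroup[OF is_group D, of ?y] l by (simp add: order_def)
        moreover have "coprime (ord ?y) (p ^ a)"
        proof -
          have "ord ?y dvd n'" using y1 yc pow_eq_id by blast
          then show ?thesis using coprime_q[OF ndvd] by (meson coprime_commute coprime_divisors dvd_refl)
        qed
        ultimately have "ord ?y dvd l" by (simp add: coprime_dvd_mult_right_iff)
        then have "?y \<in> K" using yD yc pow_eq_id unfolding K_def by blast
        moreover have "x = v \<otimes> ?y" using x(1) v by (simp flip: m_assoc)
        ultimately show "x \<in> (\<lambda>y. x [^] e \<otimes> y) ` K" using x(2) by blast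
      qed
    qed
  qed
  then have "p_fibre_sum v = (\<Sum>y\<in>K. pi_part \<pi> (ord (v \<otimes> y)))"
    unfolding p_fibre_sum_def by (rule sum.reindex_bij_betw[symmetric])
  also have "\<dots> = psi \<pi> (G\<lparr>carrier := K\<rparr>)"
    unfolding psi_subgroup_eq_sum[OF fin KG] using part by (intro sum.cong) auto
  finally show ?thesis using that[OF l pl] K KG unfolding K_def by blast
qed

text \<open>Multiplying by the group order replaces the index s of the centraliser by a factor and
  avoids division. Two estimates are chained, the induction hypothesis for the complement of order l
  and the passage from l to n' = l*s, so equality makes both sharp.\<close>

lemma fibre_bound:
  assumes "v \<in> carrier G" "u \<in> carrier G" "ord u = p ^ a" "v = u [^] (j::int)"
    and "group.fusion_free (G\<lparr>carrier := centralizer v\<rparr>) u"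
  shows "order G * p_fibre_sum v \<le> cyclic_psi \<pi> n' * card (centralizer v)"
    and "order G * p_fibre_sum v = cyclic_psi \<pi> n' * card (centralizer v) \<Longrightarrow>
      \<exists>l. card (centralizer v) = p ^ a * l \<and> subgroup {y \<in> centralizer v. y [^] l = \<one>} G
        \<and> card {y \<in> centralizer v. y [^] l = \<one>} = l
        \<and> group.hall_split (G\<lparr>carrier := {y \<in> centralizer v. y [^] l = \<one>}\<rparr>) \<pi>
        \<and> pi_part \<pi> l = pi_part \<pi> n'"
proof -
  obtain l where l: "card (centralizer v) = p ^ a * l"
    "subgroup {y \<in> centralizer v. y [^] l = \<one>} G" "card {y \<in> centralizer v. y [^] l = \<one>} = l"
    "p_fibre_sum v = psi \<pi> (G\<lparr>carrier := {y \<in> centralizer v. y [^] l = \<one>}\<rparr>)"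
    using fibre[OF assms] by blast
  let ?K = "{y \<in> centralizer v. y [^] l = \<one>}"
  have "card (centralizer v) dvd p ^ a * n'"
    unfolding lagrange[OF centralizer_subgroup[OF assms(1)], unfolded order_G, symmetric]
    by (rule dvd_triv_right)
  then have "l dvd n'" unfolding l(1) using q_pos dvd_times_left_cancel_iff[of "p ^ a"] by blast
  then obtain s where s: "n' = l * s" by blast
  then have pos: "l > 0" "s > 0" using n'_pos by auto
  have T: "p_fibre_sum v \<le> cyclic_psi \<pi> l" using IH[OF l(2)] l(3,4) by simp
  then have T1: "s * p_fibre_sum v \<le> s * cyclic_psi \<pi> l" by simp
  have T2: "s * cyclic_psi \<pi> l \<le> cyclic_psi \<pi> n'" using cyclic_psi_mult_le(1)[OF pos] s by simp
  have eq: "order G * p_fibre_sum v = card (centralizer v) * (s * p_fibre_sum v)"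
    unfolding order_G s l(1) by (simp only: ac_simps)
  have "card (centralizer v) * (s * p_fibre_sum v) \<le> card (centralizer v) * cyclic_psi \<pi> n'"
    using T1 T2 by (intro mult_le_mono2) linarith
  then show "order G * p_fibre_sum v \<le> cyclic_psi \<pi> n' * card (centralizer v)"
    unfolding eq by (simp only: mult.commute)
  assume "order G * p_fibre_sum v = cyclic_psi \<pi> n' * card (centralizer v)"
  then have "card (centralizer v) * (s * p_fibre_sum v) = card (centralizer v) * cyclic_psi \<pi> n'"
    unfolding eq by (simp only: mult.commute)
  moreover have "card (centralizer v) \<noteq> 0" using l(1) pos q_pos by simp
  ultimately have "s * p_fibre_sum v = cyclic_psi \<pi> n'" using mult_left_cancel by blast
  then have "s * p_fibre_sum v = s * cyclic_psi \<pi> l" and eq2: "s * cyclic_psi \<pi> l = cyclic_psi \<pi> n'"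
    using T1 T2 by linarith+
  then have "p_fibre_sum v = cyclic_psi \<pi> l" using pos mult_left_cancel[of s] by blast
  then have "group.hall_split (G\<lparr>carrier := ?K\<rparr>) \<pi>" using IH_eq[OF l(2)] l(3,4) by presburger
  moreover have "pi_part \<pi> l = pi_part \<pi> n'" using eq2 s cyclic_psi_mult_le(2)[OF pos] by blast
  ultimately show "\<exists>l. card (centralizer v) = p ^ a * l \<and> subgroup {y \<in> centralizer v. y [^] l = \<one>} G
        \<and> card {y \<in> centralizer v. y [^] l = \<one>} = l
        \<and> group.hall_split (G\<lparr>carrier := {y \<in> centralizer v. y [^] l = \<one>}\<rparr>) \<pi>
        \<and> pi_part \<pi> l = pi_part \<pi> n'"
    using l(1-3) by blast
qed

end

section \<open>Fusion in subgroups and the powers of a single element\<close>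

context group
begin

lemma fusion_free_subgroup:
  assumes "subgroup H G" "u \<in> H" "fusion_free u"
  shows "group.fusion_free (G\<lparr>carrier := H\<rparr>) u"
proof -
  interpret H: group "G\<lparr>carrier := H\<rparr>" using subgroup_imp_group[OF assms(1)] .
  show ?thesis unfolding H.fusion_free_def
  proof (intro ballI allI impI)
    fix s and j :: int
    assume "s \<in> carrier (G\<lparr>carrier := H\<rparr>)"
      and "s \<otimes>\<^bsub>G\<lparr>carrier := H\<rparr>\<^esub> u = u [^]\<^bsub>G\<lparr>carrier := H\<rparr>\<^esub> j \<otimes>\<^bsub>G\<lparr>carrier := H\<rparr>\<^esub> s"
    then have "s \<in> carrier G" "s \<otimes> u = u [^] j \<otimes> s"
      using subgroup.subset[OF assms(1)] int_pow_consistent[OF assms(1,2), of j] by auto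
    then show "s \<otimes>\<^bsub>G\<lparr>carrier := H\<rparr>\<^esub> u = u \<otimes>\<^bsub>G\<lparr>carrier := H\<rparr>\<^esub> s"
      using assms(3) unfolding fusion_free_def by simp
  qed
qed

lemma fusion_free_central:
  assumes "\<And>s. s \<in> carrier G \<Longrightarrow> s \<otimes> u = u \<otimes> s"
  shows "fusion_free u"
  using assms unfolding fusion_free_def by blast

lemma pow_nat_mod_ord:
  assumes "x \<in> carrier G" "ord x > 0"
  shows "x [^] nat (j mod int (ord x)) = x [^] (j::int)"
proof -
  have "int (nat (j mod int (ord x))) = j mod int (ord x)" using assms by simp
  moreover have "x [^] (j mod int (ord x)) = x [^] j"
    using int_pow_eq[OF assms(1)] by (simp add: mod_eq_dvd_iff[symmetric])
  ultimately show ?thesis by (metis int_pow_int)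
qed

lemma cyclic_powers:
  assumes x: "x \<in> carrier G" and pos: "ord x > 0"
  shows int_pow_in_powers: "x [^] (j::int) \<in> (\<lambda>i::nat. x [^] i) ` {..<ord x}"
    and sum_ord_powers: "(\<Sum>u\<in>(\<lambda>i::nat. x [^] i) ` {..<ord x}. ord u) = cyclic_order_sum (ord x)"
    and card_generators_le: "card {u \<in> (\<lambda>i::nat. x [^] i) ` {..<ord x}. ord u = ord x} \<le> totient (ord x)"
proof -
  let ?q = "ord x"
  have "nat (j mod int ?q) < ?q" using pos by (simp add: nat_less_iff)
  then show "x [^] j \<in> (\<lambda>i::nat. x [^] i) ` {..<?q}"
    using pow_nat_mod_ord[OF x pos, of j] by (metis imageI lessThan_iff)
  have ordp: "ord (x [^] i) = ?q div gcd i ?q" for i :: nat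
    using ord_pow_gen[OF x, of i] pos by (simp add: gcd.commute)
  have "{..<?q} = {0..?q - 1}" using pos by auto
  then have "inj_on (\<lambda>i::nat. x [^] i) {..<?q}" using ord_inj[OF x] by simp
  then show "(\<Sum>u\<in>(\<lambda>i::nat. x [^] i) ` {..<?q}. ord u) = cyclic_order_sum ?q"
    by (simp add: sum.reindex ordp cyclic_order_sum_gcd'[OF pos])
  have "{u \<in> (\<lambda>i::nat. x [^] i) ` {..<?q}. ord u = ?q} \<subseteq> (\<lambda>i::nat. x [^] i) ` {i \<in> {0<..?q}. gcd i ?q = 1}"
  proof clarify
    fix i assume i: "i < ?q" "ord (x [^] i) = ?q"
    then have "?q div gcd i ?q = ?q" using ordp by simp
    moreover have "gcd i ?q * (?q div gcd i ?q) = ?q" by simp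
    ultimately have "gcd i ?q * ?q = ?q" by metis
    then have g: "gcd i ?q = 1" using pos by simp
    show "x [^] i \<in> (\<lambda>i::nat. x [^] i) ` {i \<in> {0<..?q}. gcd i ?q = 1}"
    proof (cases "i = 0")
      \<comment> \<open>The totient counts exponents in \<open>{0<..?q}\<close>. The exponent 0
        gives a generator only for \<open>?q = 1\<close>, and is then replaced by
        \<open>?q\<close>.\<close>
      case True
      then have "?q = 1" using g by simp
      then have "?q \<in> {i \<in> {0<..?q}. gcd i ?q = 1}" by simp
      moreover have "x [^] i = x [^] ?q" using True pow_ord_eq_1[OF x] by (simp only: nat_pow_0)
      ultimately show ?thesis by (rule image_eqI[rotated])
    next
      case False
      then show ?thesis using i g by auto
    qed
  qed
  then have "card {u \<in> (\<lambda>i::nat. x [^] i) ` {..<?q}. ord u = ?q} \<le> card {i \<in> {0<..?q}. gcd i ?q = 1}"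
    by (rule surj_card_le[rotated]) simp
  also have "\<dots> = totient ?q" using card_gcd_eq_totient[of ?q 1] pos by simp
  finally show "card {u \<in> (\<lambda>i::nat. x [^] i) ` {..<?q}. ord u = ?q} \<le> totient ?q" .
qed

end

context psi_step
begin

lemma p_element_conj:
  assumes "w \<in> carrier G" "ord w = p ^ a" "v \<in> p_elements"
  obtains g and j :: int where "g \<in> carrier G" "v \<otimes> g = g \<otimes> w [^] j"
proof -
  interpret S: cyclic_sylow G w p a n'
    by (intro cyclic_sylow.intro cyclic_sylow_axioms.intro)
      (fact is_group fin assms(1) assms(2) p order_G ndvd a_pos)+
  show ?thesis using S.conjugate_into_sylow[of v a] assms(3) that by blast
qed

text \<open>The absence of fusion is required of every element of order p^a, because the cyclic
  Sylow subgroup through a p-element v is generated by a conjugate of w that depends on v.\<close>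

lemma psi_insert_fusion_free:
  assumes w: "w \<in> carrier G" "ord w = p ^ a"
    and ff: "\<And>u. u \<in> carrier G \<Longrightarrow> ord u = p ^ a \<Longrightarrow> fusion_free u"
  shows "psi (insert p \<pi>) G \<le> cyclic_psi (insert p \<pi>) (order G)"
    and "psi (insert p \<pi>) G = cyclic_psi (insert p \<pi>) (order G) \<Longrightarrow> hall_split (insert p \<pi>)"
proof -
  let ?R = "cyclic_psi \<pi> n'" and ?Y = "(\<lambda>i::nat. w [^] i) ` {..<p ^ a}"
  have finp: "finite p_elements" using fin by simp
  have wpos: "ord w > 0" using w q_pos by simp
  have gen: "\<exists>u. \<exists>j::int. u \<in> carrier G \<and> ord u = p ^ a \<and> v = u [^] j" if v: "v \<in> p_elements" for v
  proof -
    obtain g and j :: int where g: "g \<in> carrier G" "v \<otimes> g = g \<otimes> w [^] j"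
      using p_element_conj[OF w v] by blast
    let ?u = "g \<otimes> w \<otimes> inv g"
    have u: "?u \<in> carrier G" "g \<otimes> w = ?u \<otimes> g" using g w by (simp_all add: m_assoc)
    then have "ord ?u = p ^ a" using ord_conj_eq[OF g(1) w(1) u] w(2) by simp
    moreover have "v \<otimes> g = ?u [^] j \<otimes> g" using conj_int_pow[OF g(1) w(1) u] g(2) by simp
    then have "v = ?u [^] j" using u(1) g(1) v by simp
    ultimately show ?thesis using u(1) by blast
  qed
  have ffv: "group.fusion_free (G\<lparr>carrier := centralizer v\<rparr>) u"
    if "u \<in> carrier G" "ord u = p ^ a" "v = u [^] (j::int)" for u v j
  proof (rule fusion_free_subgroup)
    show "subgroup (centralizer v) G" using that by (intro centralizer_subgroup) simp
    show "u \<in> centralizer v" using that conj_int_pow[of u u u j] by simp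
    show "fusion_free u" using ff that by blast
  qed
  have le: "ord v * (order G * p_fibre_sum v) \<le> ord v * (?R * card (centralizer v))"
    if v: "v \<in> p_elements" for v
    using gen[OF v] fibre_bound(1)[of v] ffv v by (intro mult_le_mono2) blast
  have total: "(\<Sum>v\<in>p_elements. ord v * card (centralizer v)) \<le> order G * cyclic_order_sum (p ^ a)"
  proof -
    have "1 * (\<Sum>v\<in>p_elements. ord v * card (centralizer v)) \<le> order G * (\<Sum>u\<in>?Y. ord u)"
    proof (rule sum_centralizer_le[OF fin])
      show Y: "?Y \<subseteq> carrier G" using w by auto
      show "p_elements \<subseteq> carrier G" by blast
      show "ord u = ord v" if "g \<in> carrier G" "u \<in> ?Y" "v \<in> p_elements" "g \<otimes> u = v \<otimes> g" for g u v
        using ord_conj_eq that Y by blast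
      fix v assume v: "v \<in> p_elements"
      then obtain g and j :: int where g: "g \<in> carrier G" "v \<otimes> g = g \<otimes> w [^] j"
        using p_element_conj[OF w] by blast
      have "w [^] j \<in> ?Y" using int_pow_in_powers[OF w(1) wpos, of j] w(2) by simp
      then have "card {w [^] j} * card (centralizer v) \<le> card {(u, g) \<in> ?Y \<times> carrier G. g \<otimes> u = v \<otimes> g}"
        using v g Y by (intro card_conjugators_ge[OF fin]) (auto intro!: bexI[of _ g])
      then show "1 * card (centralizer v) \<le> card {(u, g) \<in> ?Y \<times> carrier G. g \<otimes> u = v \<otimes> g}" by simp
    qed
    then show ?thesis using sum_ord_powers[OF w(1) wpos] w(2) by simp
  qed
  have n_psi: "order G * psi (insert p \<pi>) G = (\<Sum>v\<in>p_elements. ord v * (order G * p_fibre_sum v))"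
    unfolding psi_insert_eq sum_distrib_left by (simp only: ac_simps)
  have mid: "(\<Sum>v\<in>p_elements. ord v * (?R * card (centralizer v))) = ?R * (\<Sum>v\<in>p_elements. ord v * card (centralizer v))"
    unfolding sum_distrib_left by (simp only: ac_simps)
  have cyc: "cyclic_psi (insert p \<pi>) (order G) = cyclic_order_sum (p ^ a) * ?R"
    unfolding order_G by (rule cyclic_psi_prime_power_mult(2)[OF p ndvd n'_pos p_notin])
  have le1: "order G * psi (insert p \<pi>) G \<le> (\<Sum>v\<in>p_elements. ord v * (?R * card (centralizer v)))"
    unfolding n_psi by (intro sum_mono le)
  have le2: "(\<Sum>v\<in>p_elements. ord v * (?R * card (centralizer v))) \<le> order G * cyclic_psi (insert p \<pi>) (order G)"
    unfolding mid cyc using mult_le_mono2[OF total, of ?R] by (simp only: ac_simps)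
  have n0: "order G > 0" using fin by (simp add: order_gt_0_iff_finite)
  show "psi (insert p \<pi>) G \<le> cyclic_psi (insert p \<pi>) (order G)"
    using le_trans[OF le1 le2] n0 by simp
  assume "psi (insert p \<pi>) G = cyclic_psi (insert p \<pi>) (order G)"
  \<comment> \<open>Each summand obeys its own bound, so equality of the totals forces equality for
    every v.\<close>
  then have "(\<Sum>v\<in>p_elements. ord v * (order G * p_fibre_sum v))
      = (\<Sum>v\<in>p_elements. ord v * (?R * card (centralizer v)))"
    using le1 le2 n_psi by simp
  then have "ord v * (order G * p_fibre_sum v) = ord v * (?R * card (centralizer v))"
    if "v \<in> p_elements" for v
    using sum_mono_inv[of "\<lambda>v. ord v * (order G * p_fibre_sum v)" p_elements
        "\<lambda>v. ord v * (?R * card (centralizer v))"] le that finp by blast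
  then have eq: "order G * p_fibre_sum v = ?R * card (centralizer v)" if "v \<in> p_elements" for v
    using that ord_ge_1[OF fin] by fastforce
  have split: "\<exists>l. card (centralizer v) = p ^ a * l \<and> subgroup {y \<in> centralizer v. y [^] l = \<one>} G
        \<and> card {y \<in> centralizer v. y [^] l = \<one>} = l
        \<and> group.hall_split (G\<lparr>carrier := {y \<in> centralizer v. y [^] l = \<one>}\<rparr>) \<pi>
        \<and> pi_part \<pi> l = pi_part \<pi> n'" if v: "v \<in> p_elements" for v
  proof -
    obtain u and j :: int where u: "u \<in> carrier G" "ord u = p ^ a" "v = u [^] j" using gen[OF v] by blast
    show ?thesis using fibre_bound(2)[OF _ u ffv[OF u] eq[OF v]] v by blast
  qed
  have parts: "pi_part (insert p \<pi>) (order G) = p ^ a * pi_part \<pi> n'"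
    "pi_part (pi_compl (insert p \<pi>)) (order G) = pi_part (pi_compl \<pi>) n'"
    unfolding order_G using pi_part_prime_power_mult(3,4)[OF p ndvd n'_pos p_notin] by auto
  let ?k = "pi_part (pi_compl \<pi>) n'"
  \<comment> \<open>For v = 1 the centraliser is G and K is its normal p-complement. The Hall
    subgroup of K is that of G, since x^k = 1 already implies x^n' = 1.\<close>
  have "\<one> \<in> p_elements" by simp
  from split[OF this] obtain l where l: "card (centralizer \<one>) = p ^ a * l"
    "subgroup {y \<in> centralizer \<one>. y [^] l = \<one>} G" "card {y \<in> centralizer \<one>. y [^] l = \<one>} = l"
    "group.hall_split (G\<lparr>carrier := {y \<in> centralizer \<one>. y [^] l = \<one>}\<rparr>) \<pi>" by blast
  define K where "K = {y \<in> carrier G. y [^] n' = \<one>}"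
  have C1: "centralizer \<one> = carrier G" by auto
  have "p ^ a * l = card (carrier G)" using l(1) unfolding C1 by (rule sym)
  then have "p ^ a * l = p ^ a * n'" using order_G unfolding order_def by (rule trans)
  then have "l = n'" using q_pos mult_left_cancel[of "p ^ a"] by blast
  then have K: "subgroup K G" "card K = n'" "group.hall_split (G\<lparr>carrier := K\<rparr>) \<pi>"
    using l C1 unfolding K_def by simp_all
  interpret K: group "G\<lparr>carrier := K\<rparr>" using subgroup_imp_group[OF K(1)] .
  have "{x \<in> K. x [^] ?k = \<one>} = {x \<in> carrier G. x [^] ?k = \<one>}"
  proof -
    have "x [^] n' = \<one>" if "x \<in> carrier G" "x [^] ?k = \<one>" for x
    proof -
      have "ord x dvd ?k" using that pow_eq_id by blast
      then have "ord x dvd n'" using pi_part_dvd[OF n'_pos] dvd_trans by blast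
      then show ?thesis using that(1) pow_eq_id by blast
    qed
    then show ?thesis unfolding K_def by auto
  qed
  moreover have "subgroup {x \<in> K. x [^] ?k = \<one>} (G\<lparr>carrier := K\<rparr>)" "card {x \<in> K. x [^] ?k = \<one>} = ?k"
    using K(2,3) unfolding K.hall_split_def Let_def order_def by (simp_all add: nat_pow_consistent[symmetric])
  ultimately have H: "subgroup {x \<in> carrier G. x [^] ?k = \<one>} G" "card {x \<in> carrier G. x [^] ?k = \<one>} = ?k"
    using incl_subgroup[OF K(1)] by auto
  \<comment> \<open>For v = w equality leaves the full \<pi>-part of n' in the complement inside the
    centraliser of w. It therefore contains an element c of that order commuting with w, and the
    product of c and w has the order wanted.\<close>
  have "w \<in> p_elements" using w pow_eq_id by simp
  from split[OF this] obtain l' where l': "card (centralizer w) = p ^ a * l'"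
    "subgroup {y \<in> centralizer w. y [^] l' = \<one>} G" "card {y \<in> centralizer w. y [^] l' = \<one>} = l'"
    "group.hall_split (G\<lparr>carrier := {y \<in> centralizer w. y [^] l' = \<one>}\<rparr>) \<pi>"
    "pi_part \<pi> l' = pi_part \<pi> n'" by blast
  let ?L = "{y \<in> centralizer w. y [^] l' = \<one>}"
  interpret L: group "G\<lparr>carrier := ?L\<rparr>" using subgroup_imp_group[OF l'(2)] .
  obtain c where "c \<in> ?L" "L.ord c = pi_part \<pi> l'"
    using l'(3,4) unfolding L.hall_split_def Let_def order_def by auto
  then have c: "c \<in> carrier G" "c \<otimes> w = w \<otimes> c" "ord c = pi_part \<pi> n'"
    using l'(5) ord_subgroup[OF is_group l'(2)] by auto
  have "\<not> p dvd pi_part \<pi> n'" using ndvd pi_part_dvd[OF n'_pos] dvd_trans by blast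
  then have "coprime (p ^ a) (pi_part \<pi> n')" by (rule coprime_q)
  then have "coprime (ord c) (ord w)" unfolding c(3) w(2) by (subst coprime_commute)
  then have "ord (c \<otimes> w) = pi_part (insert p \<pi>) (order G)"
    using ord_mult_coprime[OF c(1) w(1) c(2)] c(3) w(2) parts by simp
  then show "hall_split (insert p \<pi>)"
    unfolding hall_split_def Let_def parts(2) using H c(1) w(1) by blast
qed

text \<open>With z = p^(a-1) and R the cyclic value for n', let S and M be the fibre sums over the
  p-elements of order p^a and over the others. Then psi \<le> p^a S + z M = z(S+M) + z(p-1)S. The
  induction hypothesis for G itself gives S+M \<le> p^a R, and halving gives 2S \<le> R z (p-1);
  together 2 psi \<le> R z^2 (p^2+1).\<close>

lemma psi_insert_fusion:
  assumes w: "w \<in> carrier G" "ord w = p ^ a" and nff: "\<not> fusion_free w"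
  shows "psi (insert p \<pi>) G < cyclic_psi (insert p \<pi>) (order G)"
proof -
  let ?R = "cyclic_psi \<pi> n'"
  define Y where "Y = {u \<in> (\<lambda>i::nat. w [^] i) ` {..<p ^ a}. ord u = p ^ a}"
  define U where "U = {v \<in> carrier G. ord v = p ^ a}"
  define b where "b = a - 1"
  have a: "a = Suc b" using a_pos by (simp add: b_def)
  have UQ: "U \<subseteq> p_elements" using pow_eq_id by (auto simp: U_def)
  have finp: "finite p_elements" using fin by simp
  have wpos: "ord w > 0" using w q_pos by simp
  obtain s and k :: int where s: "s \<in> carrier G" "s \<otimes> w = w [^] k \<otimes> s" "s \<otimes> w \<noteq> w \<otimes> s"
    using nff unfolding fusion_free_def by blast
  have YG: "Y \<subseteq> carrier G" using w by (auto simp: Y_def)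
  \<comment> \<open>The factor 2: each v of order p^a is conjugate to a generator \<open>?u0\<close>
    of <w> and to its image \<open>?u1\<close> under s, which normalises <w> without centralising
    it.\<close>
  have "2 * (\<Sum>v\<in>U. 1 * card (centralizer v)) \<le> order G * (\<Sum>u\<in>Y. 1)"
  proof (rule sum_centralizer_le[OF fin YG])
    show "U \<subseteq> carrier G" by (auto simp: U_def)
    fix v assume v: "v \<in> U"
    then have vc: "v \<in> carrier G" "ord v = p ^ a" by (auto simp: U_def)
    obtain g and j :: int where g: "g \<in> carrier G" "v \<otimes> g = g \<otimes> w [^] j"
      using p_element_conj[OF w] v UQ by blast
    let ?u0 = "w [^] j" and ?u1 = "w [^] (k * j)"
    have su: "s \<otimes> ?u0 = ?u1 \<otimes> s"
      using conj_int_pow[OF s(1) w(1) _ s(2), of j] w(1) by (simp add: int_pow_pow)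
    have o0: "ord ?u0 = p ^ a" using ord_conj_eq[OF g(1) _ vc(1)] g(2) w(1) vc(2) by simp
    have o1: "ord ?u1 = p ^ a" using ord_conj_eq[OF s(1) _ _ su] o0 w(1) by simp
    have in_Y: "?u0 \<in> Y" "?u1 \<in> Y"
      using int_pow_in_powers[OF w(1) wpos] w(2) o0 o1 by (auto simp: Y_def)
    \<comment> \<open>If the two agreed, s would commute with a generator of <w> and hence with
      w.\<close>
    have "?u0 \<noteq> ?u1"
    proof
      assume "?u0 = ?u1"
      then have comm: "s \<otimes> ?u0 = ?u0 \<otimes> s" using su by simp
      have "coprime j (int (p ^ a))"
      proof (rule ccontr)
        assume "\<not> coprime j (int (p ^ a))"
        then have "int p dvd j" using p prime_imp_coprime[of "int p" j] by (auto simp: coprime_commute)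
        then obtain i where i: "j = int p * i" by blast
        have "?u0 [^] int (p ^ b) = w [^] (int (p ^ a) * i)"
          using w(1) i a by (simp add: int_pow_pow ac_simps)
        also have "\<dots> = \<one>" using w int_pow_eq_id[OF w(1), of "int (p ^ a) * i"] by simp
        finally have "?u0 [^] (p ^ b) = \<one>" by (simp only: int_pow_int)
        then have "p ^ a dvd p ^ b" using o0 pow_eq_id[of ?u0] w(1) by simp
        then have "a \<le> b" using p prime_gt_1_nat[OF p] by (auto dest: power_dvd_imp_le)
        then show False using a by simp
      qed
      then obtain m where m: "[j * m = 1] (mod int (p ^ a))" using cong_solve_coprime_int by blast
      have "?u0 [^] m = w [^] (1::int)"
        using m w int_pow_eq[OF w(1), of "j * m" 1] by (simp add: int_pow_pow cong_iff_dvd_diff dvd_diff_commute)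
      then have "s \<otimes> w = w \<otimes> s" using conj_int_pow[OF s(1) _ _ comm, of m] w(1) by simp
      then show False using s(3) by blast
    qed
    then have "card {?u0, ?u1} = 2" by simp
    moreover have "card {?u0, ?u1} * card (centralizer v) \<le> card {(u, g) \<in> Y \<times> carrier G. g \<otimes> u = v \<otimes> g}"
    proof (rule card_conjugators_ge[OF fin YG vc(1)])
      show "{?u0, ?u1} \<subseteq> Y" using in_Y by simp
      have "g \<otimes> inv s \<otimes> ?u1 = v \<otimes> (g \<otimes> inv s)"
      proof -
        have "?u1 = s \<otimes> ?u0 \<otimes> inv s" using su s(1) w(1) by (simp add: m_assoc)
        then have "g \<otimes> inv s \<otimes> ?u1 = g \<otimes> (inv s \<otimes> s) \<otimes> ?u0 \<otimes> inv s"
          using g(1) s(1) w(1) by (simp only: m_assoc m_closed inv_closed int_pow_closed)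
        also have "\<dots> = (v \<otimes> g) \<otimes> inv s" using g s(1) w(1) by simp
        finally show ?thesis using g(1) s(1) vc(1) by (simp add: m_assoc)
      qed
      then have "\<exists>h\<in>carrier G. h \<otimes> ?u1 = v \<otimes> h" using g(1) s(1) by blast
      moreover have "\<exists>h\<in>carrier G. h \<otimes> ?u0 = v \<otimes> h" using g by metis
      ultimately show "\<exists>h\<in>carrier G. h \<otimes> u = v \<otimes> h" if "u \<in> {?u0, ?u1}" for u using that by blast
    qed
    ultimately show "2 * card (centralizer v) \<le> card {(u, g) \<in> Y \<times> carrier G. g \<otimes> u = v \<otimes> g}" by simp
  qed auto
  then have cU: "2 * (\<Sum>v\<in>U. card (centralizer v)) \<le> order G * card Y" by simp
  define S where "S = (\<Sum>v\<in>U. p_fibre_sum v)"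
  have "order G * p_fibre_sum v \<le> ?R * card (centralizer v)" if v: "v \<in> U" for v
  proof -
    have vc: "v \<in> carrier G" "ord v = p ^ a" using v by (auto simp: U_def)
    interpret D: group "G\<lparr>carrier := centralizer v\<rparr>"
      using subgroup_imp_group[OF centralizer_subgroup[OF vc(1)]] .
    \<comment> \<open>An element of full order is central in its own centraliser, so the fibre bound
      holds for it in spite of the fusion in G.\<close>
    have "D.fusion_free v" by (rule D.fusion_free_central) simp
    then show ?thesis using fibre_bound(1)[OF vc(1) vc, of 1] vc(1) by simp
  qed
  then have "order G * S \<le> ?R * (\<Sum>v\<in>U. card (centralizer v))"
    unfolding S_def sum_distrib_left by (intro sum_mono)
  then have "order G * (2 * S) \<le> ?R * (2 * (\<Sum>v\<in>U. card (centralizer v)))" by simp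
  also have "\<dots> \<le> ?R * (order G * card Y)" using cU by (rule mult_le_mono2)
  also have "\<dots> = order G * (?R * card Y)" by (simp only: ac_simps)
  finally have "2 * S \<le> ?R * card Y" using fin by (simp add: order_gt_0_iff_finite)
  also have "card Y \<le> p ^ b * (p - 1)"
    using card_generators_le[OF w(1) wpos] w(2) totient_prime_power_Suc[OF p, of b] a by (simp add: Y_def)
  finally have S: "2 * S \<le> ?R * (p ^ b * (p - 1))" by simp
  define M where "M = (\<Sum>v\<in>p_elements - U. p_fibre_sum v)"
  have diff: "S + M = psi \<pi> G"
    unfolding psi_eq S_def M_def using sum.subset_diff[OF UQ finp, of p_fibre_sum] by simp
  have ordU: "ord v \<le> p ^ b" if v: "v \<in> p_elements - U" for v
  proof -
    obtain i where i: "ord v = p ^ i" "i \<le> a"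
      using p_elements_ord v divides_primepow_nat[OF p] by blast
    then have "i \<noteq> a" using v by (auto simp: U_def)
    then show ?thesis using i a prime_gt_0_nat[OF p] by (auto intro: power_increasing)
  qed
  have "psi (insert p \<pi>) G = (\<Sum>v\<in>U. ord v * p_fibre_sum v) + (\<Sum>v\<in>p_elements - U. ord v * p_fibre_sum v)"
    unfolding psi_insert_eq using sum.subset_diff[OF UQ finp, of "\<lambda>v. ord v * p_fibre_sum v"]
    by (simp only: add.commute)
  also have "(\<Sum>v\<in>U. ord v * p_fibre_sum v) = p ^ a * S"
    unfolding S_def sum_distrib_left by (intro sum.cong) (auto simp: U_def)
  also have "(\<Sum>v\<in>p_elements - U. ord v * p_fibre_sum v) \<le> p ^ b * (\<Sum>v\<in>p_elements - U. p_fibre_sum v)"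
    unfolding sum_distrib_left using ordU by (intro sum_mono mult_le_mono1)
  finally have main: "psi (insert p \<pi>) G \<le> p ^ a * S + p ^ b * M" by (simp add: M_def)
  have "psi \<pi> G \<le> cyclic_psi \<pi> (order G)" using IH[OF subgroup_self] by (simp add: order_def)
  also have "\<dots> = p ^ a * ?R" unfolding order_G by (rule cyclic_psi_prime_power_mult(1)[OF p ndvd n'_pos p_notin])
  finally have psi: "psi \<pi> G \<le> p ^ a * ?R" .
  have R: "?R > 0" using cyclic_psi_pos[OF n'_pos] .
  have cyc: "cyclic_psi (insert p \<pi>) (order G) = cyclic_order_sum (p ^ a) * ?R"
    unfolding order_G by (rule cyclic_psi_prime_power_mult(2)[OF p ndvd n'_pos p_notin])
  define z where "z = p ^ b"
  \<comment> \<open>With p = t + 2 and r = p - 1 no subtraction is left, and the final inequality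
    can be read off the coefficients of polynomials in t.\<close>
  obtain t where t: "p = Suc (Suc t)" using prime_ge_2_nat[OF p] by (metis add_2_eq_Suc le_Suc_ex)
  have q: "p ^ a = z + z * Suc t" using t a by (simp add: z_def)
  define r where "r = Suc t"
  have pr: "p - 1 = r" using t by (simp add: r_def)
  have "psi (insert p \<pi>) G \<le> z * (S + M) + z * r * S"
    using main unfolding q z_def[symmetric] r_def[symmetric] by (simp add: algebra_simps)
  moreover have "z * (S + M) \<le> z * ((z + z * r) * ?R)"
    using psi unfolding diff[symmetric] q r_def[symmetric] by (rule mult_le_mono2)
  moreover have "z * r * (2 * S) \<le> z * r * (?R * (z * r))"
    using S unfolding pr z_def[symmetric] by (rule mult_le_mono2)
  ultimately have "2 * psi (insert p \<pi>) G \<le> 2 * (z * ((z + z * r) * ?R)) + z * r * (?R * (z * r))"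
    by linarith
  also have "\<dots> = ?R * z * z * (2 * (r + 1) + r * r)" by (simp add: algebra_simps)
  finally have "(p + 1) * (2 * psi (insert p \<pi>) G) \<le> (p + 1) * (?R * z * z * (2 * (r + 1) + r * r))"
    by (rule mult_le_mono2)
  then have "2 * (p + 1) * psi (insert p \<pi>) G \<le> ?R * z * z * ((p + 1) * (2 * (r + 1) + r * r))"
    by (simp only: ac_simps)
  \<comment> \<open>As 2(r+1) + r^2 = p^2 + 1, this is (p+1)(p^2+1) \<le> 2p^3. Strictness comes
    next, from the summand 1 in the closed form of the cyclic order sum.\<close>
  also have "\<dots> \<le> ?R * z * z * (2 * (p * p * p))"
    unfolding r_def t by (intro mult_le_mono2) (simp add: algebra_simps)
  also have "\<dots> < 2 * ?R * (p * p * p * z * z + 1)" using R by (simp add: algebra_simps)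
  also have "p * p * p * z * z + 1 = (p + 1) * cyclic_order_sum (p ^ a)"
    unfolding cyclic_order_sum_prime_power[OF p] z_def a by (simp add: power_add mult_2)
  also have "2 * ?R * ((p + 1) * cyclic_order_sum (p ^ a)) = 2 * (p + 1) * cyclic_psi (insert p \<pi>) (order G)"
    unfolding cyc by (simp only: ac_simps)
  finally show ?thesis using mult_less_cancel1 by blast
qed

end

section \<open>The main theorem\<close>

lemma (in psi_step) ex_order_prime_power:
  assumes primes: "\<And>q. q \<in> \<pi> \<Longrightarrow> q < p"
    and ge: "cyclic_psi (insert p \<pi>) (order G) \<le> psi (insert p \<pi>) G"
  shows "\<exists>w\<in>carrier G. ord w = p ^ a"
proof -
  let ?m = "pi_part (insert p \<pi>) (order G)" and ?k = "pi_part (pi_compl (insert p \<pi>)) (order G)"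
  have n: "order G > 0" using fin by (simp add: order_gt_0_iff_finite)
  have p0: "p > 0" using p by (simp add: prime_gt_0_nat)
  have m: "?m = p ^ a * pi_part \<pi> n'"
    unfolding order_G by (rule pi_part_prime_power_mult(3)[OF p ndvd n'_pos p_notin])
  have mk: "?m * ?k = order G" "?m > 0" "?k > 0"
    using pi_part_mult_compl[OF n] pi_part_pos[OF n] by auto
  have "p ^ a > 1" using p a_pos prime_gt_1_nat one_less_power by blast
  then have m1: "?m > 1" using m mk(2) by (metis One_nat_def Suc_lessI dvd_triv_left nat_dvd_1_iff_1 less_irrefl)
  have "\<exists>x\<in>carrier G. ?m < pi_part (insert p \<pi>) (ord x) * p"
  proof (rule ccontr)
    assume "\<not> ?thesis"
    then have "pi_part (insert p \<pi>) (ord x) * p \<le> ?m" if "x \<in> carrier G" for x using that by force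
    then have "(\<Sum>x\<in>carrier G. pi_part (insert p \<pi>) (ord x) * p) \<le> (\<Sum>x\<in>carrier G. ?m)" by (rule sum_mono)
    then have le: "psi (insert p \<pi>) G * p \<le> order G * ?m"
      unfolding psi_eq_sum[OF fin] sum_distrib_right by (simp add: order_def)
    have "?m \<le> p * totient ?m"
    proof (rule le_mult_totient[OF mk(2) p0])
      fix q assume "Factorial_Ring.prime q" "q dvd ?m"
      then have "q \<in> insert p \<pi>" using pi_number_pi_part[OF n, of "insert p \<pi>"] unfolding pi_number_def by blast
      then show "q \<le> p" using primes by fastforce
    qed
    then have "?m * ?k * ?m \<le> ?m * ?k * (p * totient ?m)" by (rule mult_le_mono2)
    also have "\<dots> = ?k * (?m * totient ?m) * p" by (simp only: ac_simps)
    also have "\<dots> < ?k * cyclic_order_sum ?m * p"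
      using cyclic_order_sum_gt[OF m1] mk p0 by simp
    also have "\<dots> \<le> psi (insert p \<pi>) G * p" using ge unfolding cyclic_psi_def by simp
    finally show False using le by (simp only: mk(1) not_less[symmetric]) simp
  qed
  then obtain x where x: "x \<in> carrier G" "?m < pi_part (insert p \<pi>) (ord x) * p" by blast
  let ?d = "pi_part (insert p \<pi>) (ord x)"
  have "?d dvd ?m" using pi_part_dvd_mono ord_dvd_group_order[OF x(1)] n by blast
  then obtain f where f: "?m = ?d * f" by blast
  \<comment> \<open>A part larger than \<open>?m\<close> divided by p has a cofactor below p, hence
    prime to p, so p^a divides the part itself.\<close>
  then have "f < p" "f > 0" using x(2) mk(2) by auto
  then have "\<not> p dvd f" by (simp add: nat_dvd_not_less)
  then have "coprime (p ^ a) f" by (rule coprime_q)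
  moreover have "p ^ a dvd ?d * f" using m f by (metis dvd_triv_left)
  ultimately have "p ^ a dvd ?d" by (simp add: coprime_dvd_mult_left_iff)
  moreover have ox: "ord x > 0" using ord_ge_1[OF fin x(1)] by simp
  ultimately obtain r where r: "ord x = p ^ a * r" using pi_part_dvd dvd_trans by (metis dvdE)
  then have "r > 0" using ox by (metis mult_0_right not_gr0)
  then have "ord (x [^] r) = p ^ a" using ord_pow[OF x(1), of r] r by simp
  then show ?thesis using x(1) by blast
qed

text \<open>Primes are added in increasing order, so the one treated in a step is the largest. The
  group is quantified inside because the hypothesis is applied to subgroups; these may lose primes
  of \<pi>, and so divisibility of the order is not assumed.\<close>

lemma psi_le_cyclic_psi:
  assumes "finite \<pi>" "\<forall>q\<in>\<pi>. Factorial_Ring.prime q"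
  shows "\<forall>G :: ('a, 'b) monoid_scheme. group G \<longrightarrow> finite (carrier G) \<longrightarrow>
    psi \<pi> G \<le> cyclic_psi \<pi> (order G) \<and>
    (psi \<pi> G = cyclic_psi \<pi> (order G) \<longrightarrow> group.hall_split G \<pi>)"
  using assms
proof (induction \<pi> rule: finite_linorder_max_induct)
  case empty
  show ?case
  proof (intro allI impI)
    fix G :: "('a, 'b) monoid_scheme" (structure)
    assume "group G" and fin: "finite (carrier G)"
    then interpret group G by simp
    have n: "order G > 0" using fin by (simp add: order_gt_0_iff_finite)
    have 1: "pi_part {} m = 1" if "m > 0" for m
    proof -
      have "pi_number (pi_compl {}) m" using that by (auto simp: pi_number_def pi_compl_def)
      then show ?thesis by (rule pi_part_trivial)
    qed
    then have k: "pi_part (pi_compl {}) (order G) = order G"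
      using pi_part_mult_compl[OF n, of "{}"] n by simp
    have "psi {} G = order G" unfolding psi_eq_sum[OF fin]
      using 1 ord_ge_1[OF fin] by (simp add: order_def Suc_le_eq)
    moreover have "cyclic_psi {} (order G) = order G"
      unfolding cyclic_psi_def k 1[OF n] by (simp add: cyclic_order_sum_def)
    moreover have "{x \<in> carrier G. x [^] order G = \<one>} = carrier G" using pow_order_eq_1 by blast
    then have "hall_split {}" unfolding hall_split_def Let_def k 1[OF n]
      using subgroup_self by (auto simp: order_def intro!: bexI[of _ \<one>])
    ultimately show "psi {} G \<le> cyclic_psi {} (order G) \<and>
      (psi {} G = cyclic_psi {} (order G) \<longrightarrow> hall_split {})" by simp
  qed
next
  case (insert p A)
  then have p: "Factorial_Ring.prime p" and pA: "p \<notin> A" by auto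
  note IH = insert.IH[THEN spec, THEN mp, THEN mp]
  show ?case
  proof (intro allI impI)
    fix G :: "('a, 'b) monoid_scheme" (structure)
    assume G: "group G" and fin: "finite (carrier G)"
    then interpret group G by simp
    have n: "order G > 0" using fin by (simp add: order_gt_0_iff_finite)
    show "psi (insert p A) G \<le> cyclic_psi (insert p A) (order G) \<and>
      (psi (insert p A) G = cyclic_psi (insert p A) (order G) \<longrightarrow> hall_split (insert p A))"
    proof (cases "p dvd order G")
      case False
      note parts = pi_part_insert_ndvd[OF p False, of A]
      have "pi_part (insert p A) (ord x) = pi_part A (ord x)" if "x \<in> carrier G" for x
      proof -
        have "\<not> p dvd ord x" using False ord_dvd_group_order[OF that] dvd_trans by blast
        then show ?thesis by (rule pi_part_insert_ndvd(1)[OF p])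
      qed
      then have "psi (insert p A) G = psi A G" unfolding psi_eq_sum[OF fin] by (rule sum.cong[OF refl])
      moreover have "cyclic_psi (insert p A) (order G) = cyclic_psi A (order G)"
        unfolding cyclic_psi_def parts ..
      moreover have "hall_split (insert p A) = hall_split A" unfolding hall_split_def parts ..
      ultimately show ?thesis using IH[OF _ G fin] insert.prems by simp
    next
      case True
      obtain n' where n': "order G = p ^ multiplicity p (order G) * n'" "\<not> p dvd n'"
      proof (rule multiplicity_decompose'[of "order G" p])
        show "order G \<noteq> 0" "\<not> is_unit p" using n prime_gt_1_nat[OF p] by auto
      qed
      define a where "a = multiplicity p (order G)"
      have a: "a > 0" "order G = p ^ a * n'" using True n' by (auto simp: a_def) (metis gr0I mult_1 power_0)
      have "coprime (p ^ a) n'" using n' p by (simp add: prime_imp_coprime)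
      then obtain e where e: "[e = 1] (mod p ^ a)" "[e = 0] (mod n')"
        using binary_chinese_remainder_nat by blast
      interpret psi_step G p a n' A e
      proof (unfold_locales)
        fix K assume K: "subgroup K G"
        have *: "group (G\<lparr>carrier := K\<rparr>)" "finite (carrier (G\<lparr>carrier := K\<rparr>))"
          using subgroup_imp_group[OF K] finite_subset[OF subgroup.subset[OF K] fin] by auto
        show "psi A (G\<lparr>carrier := K\<rparr>) \<le> cyclic_psi A (card K)"
          using IH[OF _ *] insert.prems by (simp add: order_def)
        show "psi A (G\<lparr>carrier := K\<rparr>) = cyclic_psi A (card K) \<Longrightarrow> group.hall_split (G\<lparr>carrier := K\<rparr>) A"
          using IH[OF _ *] insert.prems by (simp add: order_def)
      qed (use fin p a n' e pA in \<open>auto simp: cong_0_iff\<close>)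
      show ?thesis
      proof (cases "psi (insert p A) G < cyclic_psi (insert p A) (order G)")
        case False
        then have ge: "cyclic_psi (insert p A) (order G) \<le> psi (insert p A) G" by simp
        then obtain w where w: "w \<in> carrier G" "ord w = p ^ a"
          using ex_order_prime_power insert.hyps by blast
        \<comment> \<open>Fusion at a single element of order p^a would make the inequality strict,
          against \<open>ge\<close>.\<close>
        have "fusion_free u" if "u \<in> carrier G" "ord u = p ^ a" for u
          using psi_insert_fusion[OF that] ge by linarith
        then show ?thesis using psi_insert_fusion_free[OF w] by blast
      qed simp
    qed
  qed
qed

section \<open>From normal Hall subgroups to semidirect products\<close>

lemma (in group) semidirect_product_iso:
  assumes fin: "finite (carrier G)" and H: "H \<lhd> G" and C: "subgroup C G"
    and cop: "coprime (card H) (card C)" and ord: "order G = card H * card C"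
  shows "\<exists>\<phi>. \<phi> \<in> hom (G\<lparr>carrier := C\<rparr>) (AutoGroup (G\<lparr>carrier := H\<rparr>)) \<and>
    G \<cong> semidirect_product (G\<lparr>carrier := H\<rparr>) (G\<lparr>carrier := C\<rparr>) \<phi>"
proof -
  interpret normal H G by fact
  have HG: "h \<in> H \<Longrightarrow> h \<in> carrier G" for h using subset by blast
  have CG: "c \<in> C \<Longrightarrow> c \<in> carrier G" for c using subgroup.subset[OF C] by blast
  have finH: "finite H" using fin subset finite_subset by blast
  \<comment> \<open>Elements of \<open>Bij H\<close> are undefined outside H, hence the restricted
    abstraction.\<close>
  define \<phi> where "\<phi> = (\<lambda>c. \<lambda>h\<in>H. c \<otimes> h \<otimes> inv c)"
  have conjH: "c \<otimes> h \<otimes> inv c \<in> H" if "c \<in> C" "h \<in> H" for c h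
    using inv_op_closed2 that CG by blast
  have Bij: "\<phi> c \<in> Bij H" if c: "c \<in> C" for c
  proof -
    have "inj_on (\<phi> c) H" unfolding \<phi>_def using c CG HG by (intro inj_onI) simp
    moreover have "\<phi> c ` H \<subseteq> H" unfolding \<phi>_def using conjH c by auto
    ultimately have "bij_betw (\<phi> c) H H" using endo_inj_surj[OF finH] unfolding bij_betw_def by blast
    then show ?thesis unfolding Bij_def by (simp add: \<phi>_def)
  qed
  have auto: "\<phi> c \<in> auto (G\<lparr>carrier := H\<rparr>)" if c: "c \<in> C" for c
  proof -
    have "\<phi> c (h \<otimes> h') = \<phi> c h \<otimes> \<phi> c h'" if h: "h \<in> H" "h' \<in> H" for h h'
    proof -
      have hc: "c \<in> carrier G" "h \<in> carrier G" "h' \<in> carrier G" using CG[OF c] HG h by auto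
      have "inv c \<otimes> (c \<otimes> (h' \<otimes> inv c)) = h' \<otimes> inv c" using hc by (simp flip: m_assoc)
      then have "c \<otimes> (h \<otimes> h') \<otimes> inv c = (c \<otimes> h \<otimes> inv c) \<otimes> (c \<otimes> h' \<otimes> inv c)"
        using hc by (simp add: m_assoc)
      then show ?thesis using h by (simp add: \<phi>_def)
    qed
    then have "\<phi> c \<in> hom (G\<lparr>carrier := H\<rparr>) (G\<lparr>carrier := H\<rparr>)"
      using conjH c by (auto simp: hom_def \<phi>_def)
    then show ?thesis using Bij[OF c] by (simp add: auto_def)
  qed
  have hom: "\<phi> \<in> hom (G\<lparr>carrier := C\<rparr>) (AutoGroup (G\<lparr>carrier := H\<rparr>))"
  proof (rule homI)
    fix c assume "c \<in> carrier (G\<lparr>carrier := C\<rparr>)"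
    then show "\<phi> c \<in> carrier (AutoGroup (G\<lparr>carrier := H\<rparr>))" using auto by (simp add: AutoGroup_def)
  next
    fix c d assume "c \<in> carrier (G\<lparr>carrier := C\<rparr>)" "d \<in> carrier (G\<lparr>carrier := C\<rparr>)"
    then have cd: "c \<in> C" "d \<in> C" by auto
    have "\<phi> (c \<otimes> d) = compose H (\<phi> c) (\<phi> d)"
    proof
      fix h
      show "\<phi> (c \<otimes> d) h = compose H (\<phi> c) (\<phi> d) h"
      proof (cases "h \<in> H")
        case True
        then show ?thesis using cd CG HG conjH[OF cd(2) True]
          by (simp add: \<phi>_def compose_def inv_mult_group m_assoc)
      qed (simp add: \<phi>_def compose_def)
    qed
    then show "\<phi> (c \<otimes>\<^bsub>G\<lparr>carrier := C\<rparr>\<^esub> d) = \<phi> c \<otimes>\<^bsub>AutoGroup (G\<lparr>carrier := H\<rparr>)\<^esub> \<phi> d"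
      using Bij cd by (simp add: AutoGroup_def BijGroup_def)
  qed
  let ?S = "semidirect_product (G\<lparr>carrier := H\<rparr>) (G\<lparr>carrier := C\<rparr>) \<phi>"
  let ?f = "\<lambda>(h, c). h \<otimes> c"
  have triv: "x = \<one>" if "x \<in> H" "x \<in> C" for x
  proof -
    have "x [^] card H = \<one>" "x [^] card C = \<one>"
      using pow_card_subgroup that subgroup_axioms C by auto
    then have "ord x dvd card H" "ord x dvd card C" using pow_eq_id HG that by auto
    then have "ord x = 1" using cop by (metis coprime_common_divisor_nat)
    then show ?thesis using ord_eq_1 HG that by blast
  qed
  have inj: "inj_on ?f (H \<times> C)"
  proof (rule inj_onI, clarify)
    fix h c h' c' assume a: "h \<in> H" "c \<in> C" "h' \<in> H" "c' \<in> C" "h \<otimes> c = h' \<otimes> c'"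
    note ac = HG[OF a(1)] CG[OF a(2)] HG[OF a(3)] CG[OF a(4)]
    have "inv h' \<otimes> h = inv h' \<otimes> (h \<otimes> c) \<otimes> inv c" using ac by (simp add: m_assoc)
    also have "\<dots> = c' \<otimes> inv c" unfolding a(5) using ac by (simp flip: m_assoc)
    finally have eq: "inv h' \<otimes> h = c' \<otimes> inv c" .
    moreover have "inv h' \<otimes> h \<in> H" "c' \<otimes> inv c \<in> C"
      using a subgroup.m_closed[OF C] subgroup.m_inv_closed[OF C] by auto
    ultimately have one: "c' \<otimes> inv c = \<one>" "inv h' \<otimes> h = \<one>" using triv by metis+
    then have "c = c'" using ac by (metis inv_closed inv_equality inv_inv)
    moreover from this have "h = h'" using a(5) ac by simp
    ultimately show "h = h' \<and> c = c'" by simp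
  qed
  have "?f ` (H \<times> C) \<subseteq> carrier G" using HG CG by auto
  moreover have "card (?f ` (H \<times> C)) = card (carrier G)"
    using card_image[OF inj] ord by (simp add: order_def card_cartesian_product)
  ultimately have surj: "?f ` (H \<times> C) = carrier G" using fin by (metis card_subset_eq)
  \<comment> \<open>The isomorphism decomposes an element into its pair of factors. Since its
    inverse \<open>?f\<close> is explicit, multiplicativity is checked on pairs.\<close>
  let ?g = "inv_into (H \<times> C) ?f"
  have carS: "carrier ?S = H \<times> C" by (simp add: semidirect_product_def)
  have gf: "?g (?f x) = x" if "x \<in> H \<times> C" for x by (rule inv_into_f_f[OF inj that])
  have bij: "bij_betw ?g (carrier G) (carrier ?S)"
    unfolding carS using inj surj by (intro bij_betw_inv_into) (simp add: bij_betw_def)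
  have "?g (x \<otimes> y) = ?g x \<otimes>\<^bsub>?S\<^esub> ?g y" if xy: "x \<in> carrier G" "y \<in> carrier G" for x y
  proof -
    obtain h c h' c' where hc: "h \<in> H" "c \<in> C" "x = h \<otimes> c" "h' \<in> H" "c' \<in> C" "y = h' \<otimes> c'"
      using xy unfolding surj[symmetric] by auto
    \<comment> \<open>The rearrangement (h c)(h' c') = h (c h' c^-1) (c c').\<close>
    let ?z = "(h \<otimes> \<phi> c h', c \<otimes> c')"
    have z: "?z \<in> H \<times> C" using hc conjH subgroup.m_closed[OF C] by (simp add: \<phi>_def)
    have "inv c \<otimes> (c \<otimes> c') = c'" using hc CG by (simp flip: m_assoc)
    then have "?f ?z = x \<otimes> y" using hc HG CG by (simp add: \<phi>_def m_assoc)
    then have "?g (x \<otimes> y) = ?z" using gf[OF z] by simp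
    moreover have "?g x = (h, c)" "?g y = (h', c')" using gf[of "(h, c)"] gf[of "(h', c')"] hc by auto
    ultimately show ?thesis by (simp add: semidirect_product_def)
  qed
  then have "?g \<in> hom G ?S" using bij by (auto simp: hom_def dest: bij_betw_apply)
  then have "G \<cong> ?S" unfolding is_iso_def iso_def using bij by blast
  then show ?thesis using hom by blast
qed

lemma (in group) hall_split_semidirect:
  assumes fin: "finite (carrier G)" and split: "hall_split \<pi>"
  shows "\<exists>H C \<phi>. H \<lhd> G \<and> card H = pi_part (pi_compl \<pi>) (order G) \<and>
         subgroup C G \<and> cyclic_group (G\<lparr>carrier := C\<rparr>) \<and> card C = pi_part \<pi> (order G) \<and>
         \<phi> \<in> hom (G\<lparr>carrier := C\<rparr>) (AutoGroup (G\<lparr>carrier := H\<rparr>)) \<and>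
         G \<cong> semidirect_product (G\<lparr>carrier := H\<rparr>) (G\<lparr>carrier := C\<rparr>) \<phi>"
proof -
  let ?k = "pi_part (pi_compl \<pi>) (order G)"
  have n: "order G > 0" using fin by (simp add: order_gt_0_iff_finite)
  define H where "H = {x \<in> carrier G. x [^] ?k = \<one>}"
  obtain c where H: "subgroup H G" "card H = ?k" and c: "c \<in> carrier G" "ord c = pi_part \<pi> (order G)"
    using split unfolding hall_split_def Let_def H_def by blast
  have "g \<otimes> x \<otimes> inv g \<in> H" if "g \<in> carrier G" "x \<in> H" for g x
  proof -
    have x: "x \<in> carrier G" "x [^] ?k = \<one>" using that by (auto simp: H_def)
    have "ord x = ord (g \<otimes> x \<otimes> inv g)"
      using that(1) x by (intro ord_conj_eq[of g]) (simp_all add: m_assoc)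
    then show ?thesis using x that(1) pow_eq_id unfolding H_def by simp
  qed
  then have nH: "H \<lhd> G" using normal_inv_iff H(1) by blast
  let ?C = "generate G {c}"
  have C: "subgroup ?C G" using c(1) by (intro generate_is_subgroup) simp
  have cC: "card ?C = pi_part \<pi> (order G)" using generate_pow_card[OF c(1)] c(2) by simp
  have "cyclic_group (G\<lparr>carrier := ?C\<rparr>)"
    using cyclic_group_generated[of c] c(1) by (simp add: subgroup_generated_def)
  moreover have "\<exists>\<phi>. \<phi> \<in> hom (G\<lparr>carrier := ?C\<rparr>) (AutoGroup (G\<lparr>carrier := H\<rparr>)) \<and>
      G \<cong> semidirect_product (G\<lparr>carrier := H\<rparr>) (G\<lparr>carrier := ?C\<rparr>) \<phi>"
  proof (rule semidirect_product_iso[OF fin nH C])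
    show "coprime (card H) (card ?C)"
      unfolding H(2) cC using coprime_pi_parts[OF n] by (simp add: coprime_commute)
    show "order G = card H * card ?C"
      unfolding H(2) cC using pi_part_mult_compl[OF n, of \<pi>] by (simp add: mult.commute)
  qed
  ultimately show ?thesis using nH H(2) C cC by blast
qed

lemma (in group) cyclic_subgroup_generator:
  assumes "subgroup C G" "cyclic_group (G\<lparr>carrier := C\<rparr>)"
  shows "\<exists>c\<in>C. ord c = card C"
proof -
  interpret C: group "G\<lparr>carrier := C\<rparr>" using subgroup_imp_group[OF assms(1)] .
  obtain c where c: "c \<in> C" "C = range (\<lambda>i::int. c [^]\<^bsub>G\<lparr>carrier := C\<rparr>\<^esub> i)"
    using assms(2) unfolding C.cyclic_group by auto
  have cG: "c \<in> carrier G" using c(1) subgroup.subset[OF assms(1)] by blast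
  have "C = range (\<lambda>i::int. c [^] i)" using c(2) int_pow_consistent[OF assms(1) c(1)] by simp
  then have "C = generate G {c}" unfolding generate_pow[OF cG] by auto
  then show ?thesis using generate_pow_card[OF cG] c(1) by auto
qed

theorem theorem3p1:
  fixes G :: "('a, 'b) monoid_scheme" and n :: nat and \<pi> :: "nat set"
  assumes "group G" and "finite (carrier G)" and "Coset.order G = n"
    and "\<pi> \<subseteq> prime_factors n"
  shows "psi \<pi> G \<le> psi \<pi> (integer_mod_group n) \<and>
    (psi \<pi> G = psi \<pi> (integer_mod_group n) \<longleftrightarrow>
      (\<exists>H C \<phi>. H \<lhd> G \<and> card H = pi_part (pi_compl \<pi>) n \<and>
         subgroup C G \<and> cyclic_group (G\<lparr>carrier := C\<rparr>) \<and> card C = pi_part \<pi> n \<and>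
         \<phi> \<in> hom (G\<lparr>carrier := C\<rparr>) (AutoGroup (G\<lparr>carrier := H\<rparr>)) \<and>
         G \<cong> semidirect_product (G\<lparr>carrier := H\<rparr>) (G\<lparr>carrier := C\<rparr>) \<phi>))"
    (is "_ \<and> (_ \<longleftrightarrow> ?split)")
proof -
  interpret group G by fact
  have n: "n > 0" using assms(2,3) by (auto simp: order_gt_0_iff_finite)
  have "finite \<pi>" using assms(4) finite_subset by blast
  moreover have "\<forall>q\<in>\<pi>. Factorial_Ring.prime q" using assms(4) by auto
  ultimately have main: "psi \<pi> G \<le> cyclic_psi \<pi> n" "psi \<pi> G = cyclic_psi \<pi> n \<Longrightarrow> hall_split \<pi>"
    using psi_le_cyclic_psi assms(1-3) by blast+
  have cyc: "psi \<pi> (integer_mod_group n) = cyclic_psi \<pi> n" by (rule psi_integer_mod_group[OF n])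
  have "?split" if "psi \<pi> G = cyclic_psi \<pi> n"
    using hall_split_semidirect[OF assms(2) main(2)[OF that]] unfolding assms(3) .
  moreover have "psi \<pi> G = cyclic_psi \<pi> n" if split: "?split"
  proof -
    obtain H C where H: "H \<lhd> G" "card H = pi_part (pi_compl \<pi>) n"
      and C: "subgroup C G" "cyclic_group (G\<lparr>carrier := C\<rparr>)" "card C = pi_part \<pi> n"
      using split by blast
    obtain c where c: "c \<in> C" "ord c = pi_part \<pi> n"
      using cyclic_subgroup_generator[OF C(1,2)] C(3) by auto
    have cG: "c \<in> carrier G" using c(1) subgroup.subset[OF C(1)] by blast
    show ?thesis using psi_eq_cyclic_psi[OF assms(2) H(1) cG] H(2) c(2) assms(3) by simp
  qed
  ultimately show ?thesis using main(1) cyc by metis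
qed

end
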